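(* Let $n\ge 1$ be an integer, let $A$ be a finite set, and let $u,v\in\overline{\Omega}_A\mathsf{M}$ be such that the pseudoidentity $u=v$ is provable from $\{1\le x^n\}$. (a) If $u$ and $v$ are group elements over $(\mathsf{BG})_n$, then $(\mathsf{BG})_n$ satisfies the pseudoidentity $u=v$. (b) If there are pseudowords $w,z$ such that the pseudoidentity $u=(wz)^\omega w$ is valid in $(\mathsf{BG})_n$, then so are the pseudoidentities $u=v(zw)^\omega=(wz)^\omega v$. (c) If $u$ and $v$ are regular over $(\mathsf{BG})_n$, then $(\mathsf{BG})_n$ satisfies the pseudoidentity $u=v$.
   Context: For a finite set $A$, $\overline{\Omega}_A\mathsf{M}$ is the free profinite monoid on $A$; its elements are called pseudowords. For a pseudovariety $\mathsf V$ of finite monoids, $\overline{\Omega}_A\mathsf{V}$ is the free pro-$\mathsf V$ monoid on $A$. A pseudoidentity $u=v$ (with $u,v\in\overline{\Omega}_A\mathsf M$) holds in $\mathsf V$ if $\varphi(u)=\varphi(v)$ for every continuous homomorphism $\varphi$ from $\overline{\Omega}_A\mathsf M$ to a member of $\mathsf V$. For $s$ in a profinite monoid, $s^\omega$ is the unique idempotent in the closed subsemigroup generated by $s$, and $s^{\omega+1}=s^\omega s$. $\mathsf{BG}$ is the pseudovariety of finite monoids defined by the pseudoidentity $(x^\omega y)^\omega=(yx^\omega)^\omega$ (block groups). $(\mathsf{BG})_n$ is the class of members of $\mathsf{BG}$ satisfying $(xy^\omega z)^{\omega+1}=(xy^nz)^{\omega+1}$. A pseudoword $w\in\overline{\Omega}_A\mathsf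 M$ has a property over $(\mathsf{BG})_n$ if $\pi(w)$ has it, where $\pi:\overline{\Omega}_A\mathsf M\to\overline{\Omega}_A(\mathsf{BG})_n$ is the continuous homomorphism fixing each $a\in A$. A group element is an element of a subgroup (subsemigroup that is a group) of the monoid, and an element $s$ is regular if $s=sts$ for some $t$. Provability: let $\Sigma=\{1\le x^n\}$ and fix a finite set $A$. Define binary relations $\Sigma_\alpha$ on $\overline{\Omega}_A\mathsf M$ recursively on ordinals $\alpha$: $\Sigma_0$ consists of all pairs $(w,w)$ together with all pairs $(pq,\,pt^nq)$ with $p,q,t\in\overline{\Omega}_A\mathsf M$; $\Sigma_{2\alpha+1}$ is the transitive closure of $\Sigma_{2\alpha}$; $\Sigma_{2\alpha+2}$ is the topological closure of $\Sigma_{2\alpha+1}$ in $\overline{\Omega}_A\mathsf M\times\overline{\Omega}_A\mathsf M$; and $\Sigma_\alpha=\bigcup_{\beta<\alpha}\Sigma_\beta$ for limit $\alpha$. The inequality $u\le v$ is provable from $\Sigma$ if $(u,v)\in\bigcup_\alpha\Sigma_\alpha$. The pseudoidentity $u=v$ is provable from $\Sigma$ if both $u\le v$ and $v\le u$ are. *)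

theory Defs
  imports "HOL-Algebra.Group" "HOL-Analysis.Function_Topology" "HOL-Analysis.Product_Topology"
begin

definition finite_monoid :: "'b monoid \<Rightarrow> bool" where
  "finite_monoid M \<longleftrightarrow> monoid M \<and> finite (carrier M)"

definition word_congruence :: "'a set \<Rightarrow> 'a list rel \<Rightarrow> bool" where
  "word_congruence A \<theta> \<longleftrightarrow> equiv (lists A) \<theta> \<and>
     (\<forall>(x, x') \<in> \<theta>. \<forall>(y, y') \<in> \<theta>. (x @ y, x' @ y') \<in> \<theta>)"

definition quot_mult :: "'a list rel \<Rightarrow> 'a list set \<Rightarrow> 'a list set \<Rightarrow> 'a list set" where
  "quot_mult \<theta> X Y = (\<Union>x\<in>X. \<Union>y\<in>Y. \<theta> `` {x @ y})"

definition quot_monoid :: "'a set \<Rightarrow> 'a list rel \<Rightarrow> 'a list set monoid" where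
  "quot_monoid A \<theta> = \<lparr>carrier = lists A // \<theta>, mult = quot_mult \<theta>, one = \<theta> `` {[]}\<rparr>"

text \<open>Given a pseudovariety \<open>V\<close>, the free pro-\<open>V\<close> monoid on \<open>A\<close> is the inverse limit of all
  finite quotients of the free monoid \<open>lists A\<close> that lie in \<open>V\<close>. A family is compatible
  iff its entry at the finer congruence is contained in its entry at the coarser one. The topology
  is induced by the product of the discrete topologies. With \<open>V = finite_monoid\<close> this is
  the free profinite monoid.\<close>

type_synonym 'a pseudoword = "'a list rel \<Rightarrow> 'a list set"

definition pro_index :: "('a list set monoid \<Rightarrow> bool) \<Rightarrow> 'a set \<Rightarrow> 'a list rel set" where
  "pro_index V A =
     {\<theta>. word_congruence A \<theta> \<and> finite_monoid (quot_monoid A \<theta>) \<and> V (quot_monoid A \<theta>)}"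

definition pro_carrier :: "('a list set monoid \<Rightarrow> bool) \<Rightarrow> 'a set \<Rightarrow> 'a pseudoword set" where
  "pro_carrier V A =
     {w \<in> (\<Pi>\<^sub>E \<theta>\<in>pro_index V A. lists A // \<theta>).
        \<forall>\<theta>\<in>pro_index V A. \<forall>\<theta>'\<in>pro_index V A. \<theta> \<subseteq> \<theta>' \<longrightarrow> w \<theta> \<subseteq> w \<theta>'}"

definition pro_monoid :: "('a list set monoid \<Rightarrow> bool) \<Rightarrow> 'a set \<Rightarrow> 'a pseudoword monoid" where
  "pro_monoid V A =
     \<lparr>carrier = pro_carrier V A,
      mult = (\<lambda>u v. \<lambda>\<theta>\<in>pro_index V A. quot_mult \<theta> (u \<theta>) (v \<theta>)),
      one = (\<lambda>\<theta>\<in>pro_index V A. \<theta> `` {[]})\<rparr>"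

definition pro_top :: "('a list set monoid \<Rightarrow> bool) \<Rightarrow> 'a set \<Rightarrow> 'a pseudoword topology" where
  "pro_top V A =
     subtopology (product_topology (\<lambda>\<theta>. discrete_topology (lists A // \<theta>)) (pro_index V A))
       (pro_carrier V A)"

definition pro_letter :: "('a list set monoid \<Rightarrow> bool) \<Rightarrow> 'a set \<Rightarrow> 'a \<Rightarrow> 'a pseudoword" where
  "pro_letter V A a = (\<lambda>\<theta>\<in>pro_index V A. \<theta> `` {[a]})"

abbreviation pw_monoid :: "'a set \<Rightarrow> 'a pseudoword monoid" where
  "pw_monoid \<equiv> pro_monoid finite_monoid"

abbreviation pw_top :: "'a set \<Rightarrow> 'a pseudoword topology" where
  "pw_top \<equiv> pro_top finite_monoid"

abbreviation pw_letter :: "'a set \<Rightarrow> 'a \<Rightarrow> 'a pseudoword" where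
  "pw_letter \<equiv> pro_letter finite_monoid"

text \<open>The canonical projection between inverse limits; \<open>pro_proj_hom\<close>,
  \<open>pro_proj_continuous\<close> and \<open>pro_proj_letter\<close> below show that it is a continuous
  homomorphism that fixes the letters.\<close>

definition pro_proj ::
    "('a list set monoid \<Rightarrow> bool) \<Rightarrow> 'a set \<Rightarrow> 'a pseudoword \<Rightarrow> 'a pseudoword" where
  "pro_proj V A w = restrict w (pro_index V A)"

text \<open>The set \<open>hom M N\<close> does not require preservation of the unit.\<close>

definition monoid_hom :: "'b monoid \<Rightarrow> 'c monoid \<Rightarrow> ('b \<Rightarrow> 'c) set" where
  "monoid_hom M N = {f \<in> hom M N. f \<one>\<^bsub>M\<^esub> = \<one>\<^bsub>N\<^esub>}"

definition satisfies :: "'b monoid \<Rightarrow> 'a set \<Rightarrow> 'a pseudoword \<Rightarrow> 'a pseudoword \<Rightarrow> bool" where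
  "satisfies F A u v \<longleftrightarrow>
     (\<forall>\<phi> \<in> monoid_hom (pw_monoid A) F.
        continuous_map (pw_top A) (discrete_topology (carrier F)) \<phi> \<longrightarrow> \<phi> u = \<phi> v)"

text \<open>A class of finite monoids cannot range over all types inside a definition. Classes occurring
  here are closed under isomorphism and every finite monoid has an isomorphic copy whose elements
  are natural numbers, so it suffices to test the members of that form.\<close>

definition holds_in :: "(nat monoid \<Rightarrow> bool) \<Rightarrow> 'a set \<Rightarrow> 'a pseudoword \<Rightarrow> 'a pseudoword \<Rightarrow> bool" where
  "holds_in V A u v \<longleftrightarrow> (\<forall>F. finite_monoid F \<and> V F \<longrightarrow> satisfies F A u v)"

definition closed_subsemigroup_gen :: "'b monoid \<Rightarrow> 'b topology \<Rightarrow> 'b \<Rightarrow> 'b set" where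
  "closed_subsemigroup_gen M T s =
     \<Inter>{S. S \<subseteq> carrier M \<and> closedin T S \<and> (\<forall>x\<in>S. \<forall>y\<in>S. x \<otimes>\<^bsub>M\<^esub> y \<in> S) \<and> s \<in> S}"

definition omega_pow :: "'b monoid \<Rightarrow> 'b topology \<Rightarrow> 'b \<Rightarrow> 'b" where
  "omega_pow M T s = (THE e. e \<in> closed_subsemigroup_gen M T s \<and> e \<otimes>\<^bsub>M\<^esub> e = e)"

abbreviation pw_omega :: "'a set \<Rightarrow> 'a pseudoword \<Rightarrow> 'a pseudoword" where
  "pw_omega A \<equiv> omega_pow (pw_monoid A) (pw_top A)"

abbreviation pw_omega1 :: "'a set \<Rightarrow> 'a pseudoword \<Rightarrow> 'a pseudoword" where
  "pw_omega1 A s \<equiv> pw_omega A s \<otimes>\<^bsub>pw_monoid A\<^esub> s"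

text \<open>The letters \<open>x\<close>, \<open>y\<close>, \<open>z\<close> of the defining pseudoidentities are the numbers 0, 1, 2.\<close>

definition BG :: "'b monoid \<Rightarrow> bool" where
  "BG M \<longleftrightarrow> finite_monoid M \<and>
     (let X = {0, 1 :: nat}; x = pw_letter X 0; y = pw_letter X 1
      in satisfies M X
           (pw_omega X (pw_omega X x \<otimes>\<^bsub>pw_monoid X\<^esub> y))
           (pw_omega X (y \<otimes>\<^bsub>pw_monoid X\<^esub> pw_omega X x)))"

definition BGn :: "nat \<Rightarrow> 'b monoid \<Rightarrow> bool" where
  "BGn n M \<longleftrightarrow> BG M \<and>
     (let X = {0, 1, 2 :: nat}; x = pw_letter X 0; y = pw_letter X 1; z = pw_letter X 2
      in satisfies M X
           (pw_omega1 X (x \<otimes>\<^bsub>pw_monoid X\<^esub> pw_omega X y \<otimes>\<^bsub>pw_monoid X\<^esub> z))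
           (pw_omega1 X (x \<otimes>\<^bsub>pw_monoid X\<^esub> (y [^]\<^bsub>pw_monoid X\<^esub> n) \<otimes>\<^bsub>pw_monoid X\<^esub> z)))"

text \<open>The identity of a subgroup need not be the identity of the monoid.\<close>

definition group_element :: "'b monoid \<Rightarrow> 'b \<Rightarrow> bool" where
  "group_element M s \<longleftrightarrow>
     (\<exists>H e. H \<subseteq> carrier M \<and> s \<in> H \<and> group \<lparr>carrier = H, mult = mult M, one = e\<rparr>)"

definition regular_element :: "'b monoid \<Rightarrow> 'b \<Rightarrow> bool" where
  "regular_element M s \<longleftrightarrow>
     s \<in> carrier M \<and> (\<exists>t\<in>carrier M. s = s \<otimes>\<^bsub>M\<^esub> t \<otimes>\<^bsub>M\<^esub> s)"

definition has_over :: "('a pseudoword monoid \<Rightarrow> 'a pseudoword \<Rightarrow> bool) \<Rightarrow>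
    ('a list set monoid \<Rightarrow> bool) \<Rightarrow> 'a set \<Rightarrow> 'a pseudoword \<Rightarrow> bool" where
  "has_over P V A w \<longleftrightarrow> P (pro_monoid V A) (pro_proj V A w)"

text \<open>Ordinals are the elements of a well-ordered type, each standing for the order type of the set
  of its predecessors. Every ordinal is a limit (or zero) plus a natural number \<open>k\<close>, and it
  is of the form \<open>2 \<alpha>\<close> or \<open>2 \<alpha> + 1\<close> according to the parity of \<open>k\<close>.\<close>

definition succ_of :: "'o::wellorder \<Rightarrow> 'o \<Rightarrow> bool" where
  "succ_of \<beta> \<alpha> \<longleftrightarrow> \<alpha> < \<beta> \<and> (\<forall>\<gamma><\<beta>. \<gamma> \<le> \<alpha>)"

definition pred_ord :: "'o::wellorder \<Rightarrow> 'o" where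
  "pred_ord \<beta> = (THE \<alpha>. succ_of \<beta> \<alpha>)"

lemma pred_ord_eq: "succ_of \<beta> \<alpha> \<Longrightarrow> pred_ord \<beta> = \<alpha>"
  unfolding pred_ord_def by (rule the_equality) (auto simp: succ_of_def intro: antisym)

lemma pred_ord_less: "\<exists>\<alpha>. succ_of \<beta> \<alpha> \<Longrightarrow> pred_ord \<beta> < \<beta>"
  using pred_ord_eq succ_of_def by metis

function even_ord :: "'o::wellorder \<Rightarrow> bool" where
  "even_ord \<beta> = (if \<exists>\<alpha>. succ_of \<beta> \<alpha> then \<not> even_ord (pred_ord \<beta>) else True)"
  by auto
termination
  by (relation "{(x, y). x < y}") (auto simp: wf intro: pred_ord_less)

definition sigma_base :: "nat \<Rightarrow> 'a set \<Rightarrow> 'a pseudoword rel" where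
  "sigma_base n A =
     {(w, w) | w. w \<in> carrier (pw_monoid A)} \<union>
     {(p \<otimes>\<^bsub>pw_monoid A\<^esub> q, p \<otimes>\<^bsub>pw_monoid A\<^esub> (t [^]\<^bsub>pw_monoid A\<^esub> n) \<otimes>\<^bsub>pw_monoid A\<^esub> q) | p q t.
        p \<in> carrier (pw_monoid A) \<and> q \<in> carrier (pw_monoid A) \<and> t \<in> carrier (pw_monoid A)}"

function sigma_stage :: "nat \<Rightarrow> 'a set \<Rightarrow> 'o::wellorder \<Rightarrow> 'a pseudoword rel" where
  "sigma_stage n A \<beta> =
     (if \<exists>\<alpha>. succ_of \<beta> \<alpha> then
        (if even_ord (pred_ord \<beta>) then (sigma_stage n A (pred_ord \<beta>))\<^sup>+
         else prod_topology (pw_top A) (pw_top A) closure_of sigma_stage n A (pred_ord \<beta>))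
      else if \<exists>\<alpha>. \<alpha> < \<beta> then (\<Union>\<alpha>\<in>{\<alpha>. \<alpha> < \<beta>}. sigma_stage n A \<alpha>)
      else sigma_base n A)"
  by auto
termination
  by (relation "inv_image {(x, y). x < y} (\<lambda>(n, A, \<beta>). \<beta>)") (auto simp: wf intro: pred_ord_less)

declare even_ord.simps [simp del] sigma_stage.simps [simp del]

text \<open>The type argument bounds the ordinals that are used; a theorem about
  \<open>provable TYPE('o)\<close> with a type variable \<open>'o\<close> speaks about all of them.\<close>

definition provable_le :: "'o::wellorder itself \<Rightarrow> nat \<Rightarrow> 'a set \<Rightarrow>
    'a pseudoword \<Rightarrow> 'a pseudoword \<Rightarrow> bool" where
  "provable_le _ n A u v \<longleftrightarrow> (u, v) \<in> (\<Union>\<alpha> :: 'o. sigma_stage n A \<alpha>)"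

definition provable :: "'o::wellorder itself \<Rightarrow> nat \<Rightarrow> 'a set \<Rightarrow>
    'a pseudoword \<Rightarrow> 'a pseudoword \<Rightarrow> bool" where
  "provable O' n A u v \<longleftrightarrow> provable_le O' n A u v \<and> provable_le O' n A v u"

lemma pro_index_mono: "pro_index V A \<subseteq> pro_index finite_monoid A"
  by (auto simp: pro_index_def)

lemma pro_proj_carrier:
  assumes "w \<in> pro_carrier finite_monoid A"
  shows "pro_proj V A w \<in> pro_carrier V A"
proof -
  have "\<And>\<theta>. \<theta> \<in> pro_index V A \<Longrightarrow> \<theta> \<in> pro_index finite_monoid A"
    using pro_index_mono by blast
  then show ?thesis
    using assms by (simp add: pro_carrier_def pro_proj_def PiE_iff)
qed

lemma pro_proj_hom: "pro_proj V A \<in> monoid_hom (pw_monoid A) (pro_monoid V A)"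
  using pro_index_mono[of V A]
  by (auto simp: monoid_hom_def hom_def pro_monoid_def pro_proj_carrier)
     (auto simp: pro_proj_def fun_eq_iff restrict_def)

lemma pro_proj_continuous: "continuous_map (pw_top A) (pro_top V A) (pro_proj V A)"
proof -
  have "continuous_map (pw_top A) (discrete_topology (lists A // \<theta>)) (\<lambda>w. w \<theta>)"
    if "\<theta> \<in> pro_index V A" for \<theta>
    unfolding pro_top_def
    using that pro_index_mono[of V A]
    by (intro continuous_map_from_subtopology continuous_map_product_projection) auto
  then show ?thesis
    by (auto simp: pro_top_def continuous_map_in_subtopology continuous_map_componentwise
        pro_proj_def pro_proj_carrier[unfolded pro_proj_def])
qed

lemma pro_proj_letter: "pro_proj V A (pw_letter A a) = pro_letter V A a"
  using pro_index_mono[of V A]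
  by (auto simp: pro_proj_def pro_letter_def fun_eq_iff restrict_def)

end

theory Submission
  imports Defs
begin

text \<open>Fix a member \<open>F\<close> of the pseudovariety and a continuous homomorphism \<open>\<phi>\<close> into it. In \<open>F\<close> write
  \<open>a \<succeq> b\<close> when \<open>b\<^sup>\<omega> a = b\<^sup>\<omega> b = a b\<^sup>\<omega>\<close>. This relation is transitive, and \<open>pq \<succeq> p t\<^sup>n q\<close>: by the
  defining pseudoidentity \<open>t\<^sup>n\<close> may be replaced by the idempotent \<open>f = t\<^sup>\<omega>\<close>, and in a block group
  \<open>e = (f q p)\<^sup>\<omega> = (q p f)\<^sup>\<omega>\<close>, so that all three products are equal to \<open>p e q\<close>. Hence the largest
  precongruence contained in \<open>\<succeq>\<close> contains all elementary inferences. Its preimage under \<open>\<phi>\<close> is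
  transitive and clopen, so it contains all stages of the provability relation. If both
  inequalities are provable, then \<open>x u y\<close> and \<open>x v y\<close> have the same \<open>\<omega>\<close>- and \<open>(\<omega>+1)\<close>-powers in
  \<open>F\<close> for all \<open>x\<close> and \<open>y\<close>, and (b) follows by computing with \<open>u z\<close> and \<open>z u\<close>. If \<open>u = u s u\<close> and
  \<open>v = v t v\<close>, then (b) yields \<open>u = v (s u)\<close> and \<open>v = (v t) u\<close>, whence
  \<open>v = v t u s u = v s u = u\<close>. Group elements are regular.\<close>

subsection \<open>Finite block groups\<close>

lemma (in monoid) pow_mult_shift:
  assumes "x \<in> carrier G" "y \<in> carrier G"
  shows "(x \<otimes> y) [^] (j::nat) \<otimes> x = x \<otimes> (y \<otimes> x) [^] j"
  using assms by (induction j) (simp_all add: m_assoc, simp flip: m_assoc)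

lemma (in monoid) idempotent_pow:
  assumes "e \<in> carrier G" "e \<otimes> e = e" "0 < (j::nat)"
  shows "e [^] j = e"
  using \<open>0 < j\<close> assms(1,2) by (induction j rule: nat_induct_non_zero) simp_all

text \<open>An idempotent is fixed by positive powers, so both sides equal x^(ij). Hence every
  idempotent exponent yields the same element, the value of the omega power.\<close>

lemma (in monoid) idempotent_power_unique:
  fixes i j :: nat
  assumes "x \<in> carrier G" "0 < i" "0 < j"
    and "x [^] i \<otimes> x [^] i = x [^] i" "x [^] j \<otimes> x [^] j = x [^] j"
  shows "x [^] i = x [^] j"
  using assms idempotent_pow[of "x [^] i" j] idempotent_pow[of "x [^] j" i]
  by (simp add: nat_pow_pow mult.commute)

text \<open>By the pigeonhole principle two powers coincide, so the sequence of powers is periodic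
  from some index \<open>i\<close> on with some period \<open>d\<close>.\<close>

lemma (in monoid) ex_idempotent_power:
  assumes "finite (carrier G)" "x \<in> carrier G"
  shows "\<exists>m>0. x [^] (m::nat) \<otimes> x [^] m = x [^] m"
proof -
  have "\<not> inj (\<lambda>i::nat. x [^] i)"
    using assms finite_subset[of "range (\<lambda>i::nat. x [^] i)" "carrier G"] finite_imageD[of "\<lambda>i::nat. x [^] i" UNIV]
    by auto
  then obtain i d :: nat where "0 < d" and eq: "x [^] (i + d) = x [^] i"
    by (metis (no_types, lifting) injI less_imp_add_positive linorder_neqE_nat)
  have shift: "x [^] (i + j + l * d) = x [^] (i + j)" for j l :: nat
  proof (induction l)
    case (Suc l)
    have "x [^] (i + j + Suc l * d) = x [^] (i + d) \<otimes> x [^] (j + l * d)"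
      using assms(2) by (simp add: nat_pow_mult algebra_simps)
    also have "\<dots> = x [^] (i + j + l * d)"
      unfolding eq using assms(2) by (simp add: nat_pow_mult algebra_simps)
    finally show ?case using Suc by simp
  qed simp
  \<comment> \<open>A positive multiple of the period that is at least \<open>i\<close>: doubling
    the exponent adds a multiple of \<open>d\<close> beyond the start of the periodic range.\<close>
  let ?m = "d * Suc i"
  have "i \<le> ?m"
    using \<open>0 < d\<close> by (cases d) auto
  then have "x [^] (?m + ?m) = x [^] ?m"
    using shift[of "?m - i" "Suc i"] by (simp add: mult.commute)
  then show ?thesis
    using assms(2) \<open>0 < d\<close> by (intro exI[of _ ?m]) (simp add: nat_pow_mult)
qed

text \<open>The product of the individual exponents is a multiple of each of them, and further
  powers of an idempotent change nothing. One exponent thus serves as omega for the whole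
  monoid.\<close>

lemma (in monoid) ex_idempotent_exponent:
  assumes "finite (carrier G)"
  shows "\<exists>k>0. \<forall>x\<in>carrier G. x [^] (k::nat) \<otimes> x [^] k = x [^] k"
proof -
  obtain m :: "_ \<Rightarrow> nat" where m: "\<And>x. x \<in> carrier G \<Longrightarrow> 0 < m x"
    "\<And>x. x \<in> carrier G \<Longrightarrow> x [^] m x \<otimes> x [^] m x = x [^] m x"
    using ex_idempotent_power[OF assms] by metis
  let ?k = "\<Prod>x\<in>carrier G. m x"
  have "x [^] ?k \<otimes> x [^] ?k = x [^] ?k" if x: "x \<in> carrier G" for x
  proof -
    have "x [^] ?k = (x [^] m x) [^] (\<Prod>y\<in>carrier G - {x}. m y)"
      using x assms by (simp add: nat_pow_pow prod.remove)
    also have "\<dots> = x [^] m x"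
      using m x by (intro idempotent_pow nat_pow_closed prod_pos) simp_all
    finally show ?thesis using m(2)[OF x] by simp
  qed
  moreover have "0 < ?k"
    using m by (intro prod_pos) auto
  ultimately show ?thesis by blast
qed

text \<open>The exponent \<open>k\<close> plays the role of omega. The last two assumptions are the
  defining pseudoidentities of \<open>BGn\<close> evaluated at elements, which leaves pure algebra
  with fixed exponents.\<close>

locale bg_exponent = monoid G for G :: "'a monoid" (structure) +
  fixes n k :: nat
  assumes exponent_pos: "0 < k"
    and idem: "x \<in> carrier G \<Longrightarrow> x [^] k \<otimes> x [^] k = x [^] k"
    and block: "\<lbrakk>x \<in> carrier G; y \<in> carrier G\<rbrakk> \<Longrightarrow> (x [^] k \<otimes> y) [^] k = (y \<otimes> x [^] k) [^] k"
    and insert_pow: "\<lbrakk>x \<in> carrier G; y \<in> carrier G; z \<in> carrier G\<rbrakk> \<Longrightarrow>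
      (x \<otimes> y [^] k \<otimes> z) [^] k \<otimes> (x \<otimes> y [^] k \<otimes> z) = (x \<otimes> y [^] n \<otimes> z) [^] k \<otimes> (x \<otimes> y [^] n \<otimes> z)"
begin

section \<open>Domination and the largest precongruence inside it\<close>

definition dominated :: "'a \<Rightarrow> 'a \<Rightarrow> bool" where
  "dominated a b \<longleftrightarrow> b [^] k \<otimes> a = b [^] k \<otimes> b \<and> a \<otimes> b [^] k = b [^] k \<otimes> b"

lemma exponent_commute: "x \<in> carrier G \<Longrightarrow> x \<otimes> x [^] k = x [^] k \<otimes> x"
  by (metis nat_pow_Suc nat_pow_Suc2)

lemma power_idem [simp]:
  assumes "x \<in> carrier G" shows "(x [^] k) [^] k = x [^] k"
  using assms by (intro idempotent_pow) (auto simp: idem exponent_pos)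

text \<open>The left side is x^(kk+k), which collapses by idempotency. It lets omega powers be
  recovered from (omega+1)-powers.\<close>

lemma exponent_of_Suc:
  assumes "x \<in> carrier G"
  shows "(x [^] k \<otimes> x) [^] k = x [^] k"
proof -
  have "(x [^] k \<otimes> x) [^] k = x [^] (k * k + k)"
    using assms by (metis nat_pow_Suc nat_pow_pow mult_Suc add.commute)
  also have "\<dots> = (x [^] k) [^] k \<otimes> x [^] k"
    using assms by (simp add: nat_pow_pow nat_pow_mult)
  finally show ?thesis using assms by (simp add: idem)
qed

text \<open>Next to \<open>b [^] k\<close>, which commutes with the powers of \<open>b\<close>, each
  factor \<open>a\<close> may be turned into \<open>b\<close>, one at a time. The result says that
  the idempotent of \<open>b\<close> lies below that of \<open>a\<close>.\<close>

lemma dominated_powers: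
  assumes "a \<in> carrier G" "b \<in> carrier G" "dominated a b"
  shows "b [^] k \<otimes> a [^] k = b [^] k" "a [^] k \<otimes> b [^] k = b [^] k"
proof -
  have bk: "b [^] k \<otimes> b [^] j = b [^] j \<otimes> b [^] k" for j :: nat
    using assms(2) by (simp add: nat_pow_mult add.commute)
  have "b [^] k \<otimes> a [^] j = b [^] k \<otimes> b [^] j" for j :: nat
  proof (induction j)
    case (Suc j)
    have "b [^] k \<otimes> a [^] Suc j = (b [^] k \<otimes> a [^] j) \<otimes> a"
      using assms by (simp add: m_assoc)
    also have "\<dots> = b [^] j \<otimes> (b [^] k \<otimes> a)"
      using assms by (simp add: Suc.IH bk m_assoc)
    also have "\<dots> = b [^] k \<otimes> b [^] Suc j"
      using assms unfolding dominated_def by (simp add: bk flip: m_assoc)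
    finally show ?case .
  qed simp
  then show "b [^] k \<otimes> a [^] k = b [^] k"
    using assms by (simp add: idem)
  have "a [^] j \<otimes> b [^] k = b [^] k \<otimes> b [^] j" for j :: nat
  proof (induction j)
    case (Suc j)
    have "a [^] Suc j \<otimes> b [^] k = a [^] j \<otimes> (a \<otimes> b [^] k)"
      using assms by (simp add: m_assoc)
    also have "\<dots> = (a [^] j \<otimes> b [^] k) \<otimes> b"
      using assms unfolding dominated_def by (simp add: m_assoc)
    also have "\<dots> = b [^] k \<otimes> b [^] Suc j"
      using assms by (simp add: Suc.IH m_assoc)
    finally show ?case .
  qed (use assms in simp)
  then show "a [^] k \<otimes> b [^] k = b [^] k"
    using assms by (simp add: idem)
qed

lemma dominated_refl: "a \<in> carrier G \<Longrightarrow> dominated a a"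
  by (simp add: dominated_def exponent_commute)

text \<open>Since \<open>c [^] k\<close> absorbs \<open>b [^] k\<close>, the latter can be inserted
  next to \<open>a\<close>, where it turns \<open>a\<close> into \<open>b\<close>; then
  \<open>c [^] k\<close> turns \<open>b\<close> into \<open>c\<close>.\<close>

lemma dominated_trans:
  assumes ab: "dominated a b" and bc: "dominated b c"
    and carr: "a \<in> carrier G" "b \<in> carrier G" "c \<in> carrier G"
  shows "dominated a c"
proof -
  note bc' = dominated_powers[OF carr(2,3) bc]
  have "c [^] k \<otimes> a = c [^] k \<otimes> (b [^] k \<otimes> a)"
    using carr bc'(1) by (simp flip: m_assoc)
  also have "\<dots> = c [^] k \<otimes> b"
    using ab carr bc'(1) by (simp add: dominated_def flip: m_assoc)
  finally have 1: "c [^] k \<otimes> a = c [^] k \<otimes> c"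
    using bc by (simp add: dominated_def)
  have "a \<otimes> c [^] k = (a \<otimes> b [^] k) \<otimes> c [^] k"
    using carr bc'(2) by (simp add: m_assoc)
  also have "\<dots> = b \<otimes> c [^] k"
    using ab carr bc'(2) by (simp add: dominated_def m_assoc flip: exponent_commute)
  finally show ?thesis
    using 1 bc by (simp add: dominated_def)
qed

lemma dominated_insert_idempotent:
  assumes [simp]: "p \<in> carrier G" "q \<in> carrier G" "t \<in> carrier G"
  shows "dominated (p \<otimes> q) (p \<otimes> t [^] k \<otimes> q)"
proof -
  define f where "f = t [^] k"
  define e where "e = (f \<otimes> (q \<otimes> p)) [^] k"
  have [simp]: "f \<in> carrier G" and ff: "f \<otimes> f = f"
    by (simp_all add: f_def idem)
  have [simp]: "e \<in> carrier G" by (simp add: e_def)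
  \<comment> \<open>The only use of the block group law: the two forms of \<open>e\<close> have
    \<open>f\<close> as the first and as the last factor of the base.\<close>
  have e2: "e = ((q \<otimes> p) \<otimes> f) [^] k"
    unfolding e_def f_def by (simp add: block)
  \<comment> \<open>In its second form \<open>e\<close> is a positive power of a product that ends
    in \<open>f\<close>, so it absorbs \<open>f\<close> on the right.\<close>
  have ef: "e \<otimes> f = e"
  proof -
    have "((q \<otimes> p) \<otimes> f) [^] k \<otimes> f = ((q \<otimes> p) \<otimes> f) [^] k"
      using exponent_pos by (cases k) (simp_all add: m_assoc ff)
    then show ?thesis by (simp add: e2)
  qed
  \<comment> \<open>Moving \<open>p\<close> or \<open>q\<close> through the power of p f q turns it
    into one of the two forms of \<open>e\<close>; all three products in \<open>dominated\<close>
    then reduce to p e q.\<close>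
  have b: "(p \<otimes> f \<otimes> q) [^] k \<otimes> p = p \<otimes> e"
    using pow_mult_shift[of p "f \<otimes> q" k] by (simp add: e_def m_assoc)
  have "q \<otimes> (p \<otimes> f \<otimes> q) [^] k = e \<otimes> q"
    using pow_mult_shift[of q "p \<otimes> f" k] by (simp add: e2 m_assoc)
  then have "(p \<otimes> q) \<otimes> (p \<otimes> f \<otimes> q) [^] k = p \<otimes> (e \<otimes> q)"
    by (simp add: m_assoc)
  moreover have "(p \<otimes> f \<otimes> q) [^] k \<otimes> (p \<otimes> q) = p \<otimes> (e \<otimes> q)"
  proof -
    have "(p \<otimes> f \<otimes> q) [^] k \<otimes> (p \<otimes> q) = ((p \<otimes> f \<otimes> q) [^] k \<otimes> p) \<otimes> q"
      by (simp add: m_assoc)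
    also have "\<dots> = p \<otimes> (e \<otimes> q)"
      unfolding b by (simp add: m_assoc)
    finally show ?thesis .
  qed
  moreover have "(p \<otimes> f \<otimes> q) [^] k \<otimes> (p \<otimes> f \<otimes> q) = p \<otimes> (e \<otimes> q)"
  proof -
    have "(p \<otimes> f \<otimes> q) [^] k \<otimes> (p \<otimes> f \<otimes> q) = ((p \<otimes> f \<otimes> q) [^] k \<otimes> p) \<otimes> f \<otimes> q"
      by (simp add: m_assoc)
    also have "\<dots> = p \<otimes> (e \<otimes> f) \<otimes> q"
      unfolding b by (simp add: m_assoc)
    finally show ?thesis by (simp add: ef m_assoc)
  qed
  ultimately show ?thesis
    by (simp add: dominated_def f_def)
qed

text \<open>Domination depends on its second argument only through that argument's omega and
  (omega+1)-powers. By \<open>insert_pow\<close> the latter agree for t^n and t^k, and by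
  \<open>exponent_of_Suc\<close> so do the former.\<close>

lemma dominated_insert:
  assumes [simp]: "p \<in> carrier G" "q \<in> carrier G" "t \<in> carrier G"
  shows "dominated (p \<otimes> q) (p \<otimes> t [^] n \<otimes> q)"
proof -
  let ?b = "p \<otimes> t [^] n \<otimes> q" and ?c = "p \<otimes> t [^] k \<otimes> q"
  have eq: "?b [^] k \<otimes> ?b = ?c [^] k \<otimes> ?c"
    by (simp add: insert_pow)
  have "?b [^] k = ?c [^] k"
    using exponent_of_Suc[of ?b] exponent_of_Suc[of ?c] eq by simp
  then show ?thesis
    using dominated_insert_idempotent[OF assms] eq by (simp add: dominated_def)
qed

text \<open>Domination in every two-sided context. The contexts with one side trivial are what later
  allows v z and z v to be compared with u z and z u.\<close>

definition le :: "'a rel" where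
  "le = {(a, b) \<in> carrier G \<times> carrier G. \<forall>x\<in>carrier G. \<forall>y\<in>carrier G. dominated (x \<otimes> a \<otimes> y) (x \<otimes> b \<otimes> y)}"

lemma le_carrier: "(a, b) \<in> le \<Longrightarrow> a \<in> carrier G" "(a, b) \<in> le \<Longrightarrow> b \<in> carrier G"
  by (simp_all add: le_def)

lemma le_dominated:
  "\<lbrakk>(a, b) \<in> le; x \<in> carrier G; y \<in> carrier G\<rbrakk> \<Longrightarrow> dominated (x \<otimes> a \<otimes> y) (x \<otimes> b \<otimes> y)"
  by (simp add: le_def)

lemma le_refl: "a \<in> carrier G \<Longrightarrow> (a, a) \<in> le"
  by (simp add: le_def dominated_refl)

lemma trans_le: "trans le"
proof (rule transI)
  fix a b c assume ab: "(a, b) \<in> le" and bc: "(b, c) \<in> le"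
  then have "dominated (x \<otimes> a \<otimes> y) (x \<otimes> c \<otimes> y)" if "x \<in> carrier G" "y \<in> carrier G" for x y
    using dominated_trans[OF le_dominated[OF ab that] le_dominated[OF bc that]] that
    by (simp add: le_carrier[OF ab] le_carrier[OF bc])
  then show "(a, c) \<in> le"
    using le_carrier(1)[OF ab] le_carrier(2)[OF bc] by (simp add: le_def)
qed

text \<open>A context around an elementary inference merges with \<open>p\<close> and
  \<open>q\<close> into another elementary inference.\<close>

lemma le_insert:
  assumes [simp]: "p \<in> carrier G" "q \<in> carrier G" "t \<in> carrier G"
  shows "(p \<otimes> q, p \<otimes> t [^] n \<otimes> q) \<in> le"
proof -
  have "dominated (x \<otimes> (p \<otimes> q) \<otimes> y) (x \<otimes> (p \<otimes> t [^] n \<otimes> q) \<otimes> y)"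
    if [simp]: "x \<in> carrier G" "y \<in> carrier G" for x y
    using dominated_insert[of "x \<otimes> p" "q \<otimes> y" t] by (simp add: m_assoc)
  then show ?thesis
    by (simp add: le_def)
qed

text \<open>Domination both ways puts each of the two idempotents below the other, so they are
  equal.\<close>

lemma le_antisym_powers:
  assumes "(a, b) \<in> le" "(b, a) \<in> le" "x \<in> carrier G" "y \<in> carrier G"
  shows "(x \<otimes> a \<otimes> y) [^] k = (x \<otimes> b \<otimes> y) [^] k"
    and "(x \<otimes> a \<otimes> y) [^] k \<otimes> (x \<otimes> a \<otimes> y) = (x \<otimes> a \<otimes> y) [^] k \<otimes> (x \<otimes> b \<otimes> y)"
proof -
  let ?a = "x \<otimes> a \<otimes> y" and ?b = "x \<otimes> b \<otimes> y"
  have carr: "?a \<in> carrier G" "?b \<in> carrier G" and d: "dominated ?a ?b" "dominated ?b ?a"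
    using assms by (simp_all add: le_carrier le_dominated)
  show "?a [^] k = ?b [^] k"
    using dominated_powers[OF carr d(1)] dominated_powers[OF carr(2,1) d(2)] by simp
  show "?a [^] k \<otimes> ?a = ?a [^] k \<otimes> ?b"
    using d(2) by (simp add: dominated_def)
qed

text \<open>Here u z and z u are the (omega+1)-powers of w z and z w, so
  \<open>le_antisym_powers\<close> transfers their idempotents \<open>E\<close> and \<open>H\<close>
  to v z and z v. This gives E v = v H. Two evaluations of u z v then show v H (z w) = w H (z w),
  and z w can be cancelled next to \<open>H\<close>.\<close>

lemma le_antisym_stable:
  assumes uv: "(u, v) \<in> le" "(v, u) \<in> le"
    and [simp]: "w \<in> carrier G" "z \<in> carrier G"
    and u: "u = (w \<otimes> z) [^] k \<otimes> w"
  shows "v \<otimes> (z \<otimes> w) [^] k = u" "(w \<otimes> z) [^] k \<otimes> v = u"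
proof -
  have [simp]: "u \<in> carrier G" "v \<in> carrier G"
    using le_carrier[OF uv(1)] by simp_all
  define E where "E = (w \<otimes> z) [^] k"
  define H where "H = (z \<otimes> w) [^] k"
  have [simp]: "E \<in> carrier G" "H \<in> carrier G" by (simp_all add: E_def H_def)
  have HH: "H \<otimes> H = H" by (simp add: H_def idem)
  have uH: "u = w \<otimes> H"
    by (simp add: u H_def pow_mult_shift)
  have zu: "z \<otimes> u = H \<otimes> (z \<otimes> w)"
  proof -
    have "z \<otimes> u = z \<otimes> (w \<otimes> z) [^] k \<otimes> w" by (simp add: u m_assoc)
    then show ?thesis by (simp add: H_def m_assoc flip: pow_mult_shift)
  qed
  have zuk: "(z \<otimes> u) [^] k = H"
    unfolding zu H_def by (rule exponent_of_Suc) simp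
  \<comment> \<open>The context is \<open>z\<close> on the left and the unit on the right.\<close>
  have zvk: "(z \<otimes> v) [^] k = H"
    using le_antisym_powers(1)[OF uv, of z \<one>] zuk by simp
  have "H \<otimes> (z \<otimes> u) = H \<otimes> (z \<otimes> v)"
    using le_antisym_powers(2)[OF uv, of z \<one>] zuk by simp
  then have Hzv: "H \<otimes> (z \<otimes> v) = H \<otimes> (z \<otimes> w)"
    by (simp add: zu HH flip: m_assoc)
  have uz: "u \<otimes> z = E \<otimes> (w \<otimes> z)"
    by (simp add: u E_def m_assoc)
  have uzk: "(u \<otimes> z) [^] k = E"
    unfolding uz E_def by (rule exponent_of_Suc) simp
  have vzk: "(v \<otimes> z) [^] k = E"
    using le_antisym_powers(1)[OF uv, of \<one> z] uzk by simp
  have "E \<otimes> (u \<otimes> z) = E \<otimes> (v \<otimes> z)"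
    using le_antisym_powers(2)[OF uv, of \<one> z] uzk by simp
  then have Evz: "E \<otimes> (v \<otimes> z) = E \<otimes> (w \<otimes> z)"
    by (simp add: uz E_def idem flip: m_assoc)
  have EvH: "E \<otimes> v = v \<otimes> H"
    using pow_mult_shift[of v z k] by (simp add: vzk zvk)
  \<comment> \<open>First evaluation of u z v, through \<open>E\<close>; the second one, through
    \<open>H\<close>, starts from u = w H.\<close>
  have "u \<otimes> (z \<otimes> v) = E \<otimes> (v \<otimes> z) \<otimes> v"
    by (simp add: Evz m_assoc u flip: E_def)
  also have "\<dots> = v \<otimes> (H \<otimes> (z \<otimes> v))"
    using EvH by (simp flip: m_assoc)
  finally have "v \<otimes> (H \<otimes> (z \<otimes> w)) = u \<otimes> (z \<otimes> v)"
    by (simp add: Hzv)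
  also have "\<dots> = w \<otimes> (H \<otimes> (z \<otimes> w))"
    by (simp add: uH m_assoc Hzv)
  finally have vw: "v \<otimes> H \<otimes> (z \<otimes> w) = w \<otimes> H \<otimes> (z \<otimes> w)"
    by (simp add: m_assoc)
  \<comment> \<open>Cancellation: multiplying by (z w)^j on the right completes the factor z w to
    \<open>H\<close>.\<close>
  obtain j where k: "k = Suc j"
    using exponent_pos gr0_conv_Suc by blast
  have H: "H = (z \<otimes> w) \<otimes> (z \<otimes> w) [^] j"
    using nat_pow_Suc2[of "z \<otimes> w" j] by (simp add: H_def k)
  have "v \<otimes> H \<otimes> H = (v \<otimes> H \<otimes> (z \<otimes> w)) \<otimes> (z \<otimes> w) [^] j"
    by (subst (2) H) (simp add: m_assoc)
  also have "\<dots> = w \<otimes> H \<otimes> H"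
    unfolding vw by (subst (3) H) (simp add: m_assoc)
  finally have vH: "v \<otimes> H = u"
    by (simp add: uH m_assoc HH)
  then show "v \<otimes> (z \<otimes> w) [^] k = u" by (simp add: H_def)
  show "(w \<otimes> z) [^] k \<otimes> v = u"
    using vH EvH by (simp add: E_def)
qed

lemma le_antisym_regular:
  assumes uv: "(u, v) \<in> le" "(v, u) \<in> le" and u: "regular_element G u" and v: "regular_element G v"
  shows "u = v"
proof -
  \<comment> \<open>With a = a t a the products a t and t a are idempotent, so a = (a t)^k a has the
    form required by \<open>le_antisym_stable\<close> with w = a and z = t. The witnesses are s = t
    a and r = a t.\<close>
  have half: "\<exists>s\<in>carrier G. b \<otimes> s = a \<and> a \<otimes> s = a \<and> (\<exists>r\<in>carrier G. r \<otimes> b = a)"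
    if ab: "(a, b) \<in> le" "(b, a) \<in> le" and a: "regular_element G a" for a b
  proof -
    obtain t where [simp]: "a \<in> carrier G" "t \<in> carrier G" and t: "a \<otimes> t \<otimes> a = a"
      using a by (auto simp: regular_element_def)
    have at: "(a \<otimes> t) [^] k = a \<otimes> t"
      using t exponent_pos by (intro idempotent_pow) (simp_all flip: m_assoc)
    have ta: "(t \<otimes> a) [^] k = t \<otimes> a"
      using t exponent_pos by (intro idempotent_pow) (simp_all add: m_assoc)
    have "a = (a \<otimes> t) [^] k \<otimes> a"
      by (simp add: at t)
    from le_antisym_stable[OF ab _ _ this]
    have "b \<otimes> (t \<otimes> a) = a" "(a \<otimes> t) \<otimes> b = a" by (simp_all add: at ta)
    then show ?thesis
      using t by (intro bexI[of _ "t \<otimes> a"]) (auto simp: m_assoc)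
  qed
  have [simp]: "u \<in> carrier G" "v \<in> carrier G"
    using le_carrier[OF uv(1)] by simp_all
  obtain s where [simp]: "s \<in> carrier G" and s: "v \<otimes> s = u" "u \<otimes> s = u"
    using half[OF uv u] by blast
  obtain r where [simp]: "r \<in> carrier G" and r: "r \<otimes> u = v"
    using half[OF uv(2,1) v] by blast
  \<comment> \<open>Because v = r u and u s = u.\<close>
  have "v \<otimes> s = v"
    using s(2) r by (metis \<open>r \<in> carrier G\<close> \<open>s \<in> carrier G\<close> \<open>u \<in> carrier G\<close> m_assoc)
  then show ?thesis using s(1) by simp
qed

end

subsection \<open>The inverse limit of the finite quotients\<close>

lemma word_congruenceD:
  assumes "word_congruence A \<theta>"
  shows "equiv (lists A) \<theta>"
    and "(x, x') \<in> \<theta> \<Longrightarrow> (y, y') \<in> \<theta> \<Longrightarrow> (x @ y, x' @ y') \<in> \<theta>"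
  using assms by (auto simp: word_congruence_def)

text \<open>By compatibility all classes in the union defining \<open>quot_mult\<close> coincide, so
  the product does not depend on representatives.\<close>

lemma quot_mult_class:
  assumes \<theta>: "word_congruence A \<theta>" and x: "x \<in> lists A" and y: "y \<in> lists A"
  shows "quot_mult \<theta> (\<theta> `` {x}) (\<theta> `` {y}) = \<theta> `` {x @ y}"
proof -
  note eq = word_congruenceD(1)[OF \<theta>]
  have const: "\<theta> `` {x' @ y'} = \<theta> `` {x @ y}" if "(x, x') \<in> \<theta>" "(y, y') \<in> \<theta>" for x' y'
    using equiv_class_eq[OF eq word_congruenceD(2)[OF \<theta> that]] by (rule sym)
  have x': "x \<in> \<theta> `` {x}" and y': "y \<in> \<theta> `` {y}"
    using x y equiv_class_self[OF eq] by blast+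
  show ?thesis
    unfolding quot_mult_def
    by (intro SUP_eq_const const) (use x' y' in auto)
qed

lemma quot_monoid_simps [simp]:
  "carrier (quot_monoid A \<theta>) = lists A // \<theta>"
  "X \<otimes>\<^bsub>quot_monoid A \<theta>\<^esub> Y = quot_mult \<theta> X Y"
  "\<one>\<^bsub>quot_monoid A \<theta>\<^esub> = \<theta> `` {[]}"
  by (simp_all add: quot_monoid_def)

lemma monoid_quot_monoid:
  assumes \<theta>: "word_congruence A \<theta>"
  shows "monoid (quot_monoid A \<theta>)"
proof (rule monoidI, goal_cases)
  case (1 X Y)
  then obtain x y where "x \<in> lists A" "y \<in> lists A" "X = \<theta> `` {x}" "Y = \<theta> `` {y}"
    unfolding quot_monoid_simps by (meson quotientE)
  then show ?case
    by (simp add: quot_mult_class[OF \<theta>] quotientI)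
next
  case (3 X Y Z)
  then obtain x y z where "x \<in> lists A" "y \<in> lists A" "z \<in> lists A"
    "X = \<theta> `` {x}" "Y = \<theta> `` {y}" "Z = \<theta> `` {z}"
    unfolding quot_monoid_simps by (meson quotientE)
  then show ?case
    by (simp add: quot_mult_class[OF \<theta>])
next
  case (4 X)
  then obtain x where "x \<in> lists A" "X = \<theta> `` {x}"
    unfolding quot_monoid_simps by (rule quotientE)
  then show ?case
    by (simp add: quot_mult_class[OF \<theta>])
next
  case (5 X)
  then obtain x where "x \<in> lists A" "X = \<theta> `` {x}"
    unfolding quot_monoid_simps by (rule quotientE)
  then show ?case
    by (simp add: quot_mult_class[OF \<theta>])
qed (simp add: quotientI)

lemma pro_index_iff:
  "\<theta> \<in> pro_index V A \<longleftrightarrow> word_congruence A \<theta> \<and> finite (lists A // \<theta>) \<and> V (quot_monoid A \<theta>)"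
  by (auto simp: pro_index_def finite_monoid_def monoid_quot_monoid)

lemma pro_index_finite_iff:
  "\<theta> \<in> pro_index finite_monoid A \<longleftrightarrow> word_congruence A \<theta> \<and> finite (lists A // \<theta>)"
  by (auto simp: pro_index_iff finite_monoid_def monoid_quot_monoid)

text \<open>A class of the intersection is an intersection of two classes, of which there are
  finitely many. This makes the index set directed.\<close>

lemma pro_index_Int:
  assumes "\<theta> \<in> pro_index finite_monoid A" "\<theta>' \<in> pro_index finite_monoid A"
  shows "\<theta> \<inter> \<theta>' \<in> pro_index finite_monoid A"
proof -
  have "word_congruence A (\<theta> \<inter> \<theta>')"
  proof -
    have wc: "word_congruence A \<theta>" "word_congruence A \<theta>'"
      using assms by (simp_all add: pro_index_finite_iff)
    then have "equiv (lists A) (\<theta> \<inter> \<theta>')"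
      using wc[THEN word_congruenceD(1)] unfolding equiv_def
      by (auto intro: sym_Int trans_Int simp: refl_on_def)
    then show ?thesis
      using wc[THEN word_congruenceD(2)] unfolding word_congruence_def by blast
  qed
  moreover have "lists A // (\<theta> \<inter> \<theta>') \<subseteq> (\<lambda>(X, Y). X \<inter> Y) ` ((lists A // \<theta>) \<times> (lists A // \<theta>'))"
  proof
    fix Z assume "Z \<in> lists A // (\<theta> \<inter> \<theta>')"
    then obtain x where "x \<in> lists A" "Z = (\<theta> \<inter> \<theta>') `` {x}"
      by (rule quotientE)
    then show "Z \<in> (\<lambda>(X, Y). X \<inter> Y) ` ((lists A // \<theta>) \<times> (lists A // \<theta>'))"
      by (intro rev_image_eqI[of "(\<theta> `` {x}, \<theta>' `` {x})"]) (auto simp: quotientI)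
  qed
  ultimately show ?thesis
    using assms finite_subset unfolding pro_index_finite_iff by blast
qed

lemma pro_index_universal: "lists A \<times> lists A \<in> pro_index finite_monoid A"
proof -
  have "lists A // (lists A \<times> lists A) \<subseteq> {lists A}"
    by (auto elim!: quotientE)
  moreover have "word_congruence A (lists A \<times> lists A)"
    by (auto simp: word_congruence_def equiv_def refl_on_def sym_def trans_def)
  ultimately show ?thesis
    using finite_subset unfolding pro_index_finite_iff by blast
qed

text \<open>Finitely many coordinates can be controlled by a single finer one; the universal
  congruence handles the empty set.\<close>

lemma pro_index_Inter_bound:
  assumes "finite J" "J \<subseteq> pro_index finite_monoid A"
  shows "\<exists>\<theta>\<in>pro_index finite_monoid A. \<forall>\<theta>'\<in>J. \<theta> \<subseteq> \<theta>'"
  using assms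
proof (induction J)
  case empty
  then show ?case using pro_index_universal by blast
next
  case (insert \<theta>1 J)
  then obtain \<theta> where "\<theta> \<in> pro_index finite_monoid A" "\<forall>\<theta>'\<in>J. \<theta> \<subseteq> \<theta>'" by auto
  then show ?case
    using insert.prems by (intro bexI[of _ "\<theta> \<inter> \<theta>1"]) (auto intro: pro_index_Int)
qed

section \<open>Coordinates and monoid structure of the limit\<close>

lemma pro_monoid_simps [simp]:
  "carrier (pro_monoid V A) = pro_carrier V A"
  "\<theta> \<in> pro_index V A \<Longrightarrow> (u \<otimes>\<^bsub>pro_monoid V A\<^esub> v) \<theta> = quot_mult \<theta> (u \<theta>) (v \<theta>)"
  "\<theta> \<in> pro_index V A \<Longrightarrow> (\<one>\<^bsub>pro_monoid V A\<^esub>) \<theta> = \<theta> `` {[]}"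
  by (simp_all add: pro_monoid_def)

lemma pro_carrier_coord:
  "\<lbrakk>w \<in> pro_carrier V A; \<theta> \<in> pro_index V A\<rbrakk> \<Longrightarrow> w \<theta> \<in> lists A // \<theta>"
  by (auto simp: pro_carrier_def)

lemma pro_carrier_mono:
  "\<lbrakk>w \<in> pro_carrier V A; \<theta> \<in> pro_index V A; \<theta>' \<in> pro_index V A; \<theta> \<subseteq> \<theta>'\<rbrakk> \<Longrightarrow> w \<theta> \<subseteq> w \<theta>'"
  by (simp add: pro_carrier_def)

lemma pro_carrier_eqI:
  assumes "u \<in> pro_carrier V A" "v \<in> pro_carrier V A" "\<And>\<theta>. \<theta> \<in> pro_index V A \<Longrightarrow> u \<theta> = v \<theta>"
  shows "u = v"
  using assms by (intro PiE_ext[of u "pro_index V A" "\<lambda>\<theta>. lists A // \<theta>"]) (auto simp: pro_carrier_def)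

text \<open>The common class at the finer congruence is nonempty and lies in both classes at the
  coarser one, which therefore coincide.\<close>

lemma pro_carrier_coarser:
  assumes "u \<in> pro_carrier V A" "v \<in> pro_carrier V A" "\<theta> \<in> pro_index V A" "\<theta>' \<in> pro_index V A"
    and "\<theta> \<subseteq> \<theta>'" "u \<theta> = v \<theta>"
  shows "u \<theta>' = v \<theta>'"
proof -
  have eq: "equiv (lists A) \<theta>" "equiv (lists A) \<theta>'"
    using assms by (auto simp: pro_index_iff word_congruence_def)
  have "u \<theta> \<noteq> {}"
    using pro_carrier_coord[OF assms(1,3)] eq(1) in_quotient_imp_non_empty by blast
  moreover have "u \<theta> \<subseteq> u \<theta>'" "u \<theta> \<subseteq> v \<theta>'"
    using pro_carrier_mono[OF assms(1,3-5)] pro_carrier_mono[OF assms(2-5)] assms(6) by simp_all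
  ultimately show ?thesis
    using quotient_disj[OF eq(2) pro_carrier_coord[OF assms(1,4)] pro_carrier_coord[OF assms(2,4)]]
    by blast
qed

lemma quot_monoid_pro_index: "\<theta> \<in> pro_index V A \<Longrightarrow> monoid (quot_monoid A \<theta>)"
  by (simp add: pro_index_iff monoid_quot_monoid)

lemma monoid_pro_monoid: "monoid (pro_monoid V A)"
proof (rule monoidI, goal_cases)
  case (1 u v)
  have "quot_mult \<theta> (u \<theta>) (v \<theta>) \<in> lists A // \<theta>" if "\<theta> \<in> pro_index V A" for \<theta>
    using monoid.m_closed[OF quot_monoid_pro_index[OF that]] 1 that by (simp add: pro_carrier_coord)
  moreover have "quot_mult \<theta> (u \<theta>) (v \<theta>) \<subseteq> quot_mult \<theta>' (u \<theta>') (v \<theta>')"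
    if "\<theta> \<in> pro_index V A" "\<theta>' \<in> pro_index V A" "\<theta> \<subseteq> \<theta>'" for \<theta> \<theta>'
  proof -
    have "u \<theta> \<subseteq> u \<theta>'" "v \<theta> \<subseteq> v \<theta>'"
      using 1 that by (simp_all add: pro_carrier_mono)
    then show ?thesis
      using that(3) unfolding quot_mult_def by blast
  qed
  ultimately show ?case
    by (simp add: pro_carrier_def pro_monoid_def)
next
  case 2
  then show ?case
    by (auto simp: pro_carrier_def pro_monoid_def quotientI)
next
  case (3 u v w)
  then show ?case
    using monoid.m_assoc[OF quot_monoid_pro_index]
    by (fastforce simp: pro_monoid_def pro_carrier_coord)
next
  case (4 u)
  then have "(\<one>\<^bsub>pro_monoid V A\<^esub> \<otimes>\<^bsub>pro_monoid V A\<^esub> u) \<theta> = u \<theta>" for \<theta>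
    using monoid.l_one[OF quot_monoid_pro_index, of \<theta> V A "u \<theta>"]
    by (cases "\<theta> \<in> pro_index V A") (auto simp: pro_monoid_def pro_carrier_coord pro_carrier_def)
  then show ?case by (rule ext)
next
  case (5 u)
  then have "(u \<otimes>\<^bsub>pro_monoid V A\<^esub> \<one>\<^bsub>pro_monoid V A\<^esub>) \<theta> = u \<theta>" for \<theta>
    using monoid.r_one[OF quot_monoid_pro_index, of \<theta> V A "u \<theta>"]
    by (cases "\<theta> \<in> pro_index V A") (auto simp: pro_monoid_def pro_carrier_coord pro_carrier_def)
  then show ?case by (rule ext)
qed

lemma pw_mult_closed:
  "\<lbrakk>u \<in> pro_carrier finite_monoid A; v \<in> pro_carrier finite_monoid A\<rbrakk> \<Longrightarrow> u \<otimes>\<^bsub>pw_monoid A\<^esub> v \<in> pro_carrier finite_monoid A"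
  using monoid.m_closed[OF monoid_pro_monoid, of u finite_monoid A v] by simp

lemma pw_pow_closed:
  "u \<in> pro_carrier finite_monoid A \<Longrightarrow> u [^]\<^bsub>pw_monoid A\<^esub> (j::nat) \<in> pro_carrier finite_monoid A"
  using monoid.nat_pow_closed[OF monoid_pro_monoid, of u finite_monoid A] by simp

lemma pro_pow_coord:
  assumes "\<theta> \<in> pro_index V A"
  shows "(s [^]\<^bsub>pro_monoid V A\<^esub> (m::nat)) \<theta> = s \<theta> [^]\<^bsub>quot_monoid A \<theta>\<^esub> m"
  using assms by (induction m) simp_all

text \<open>The image of a finite word in the limit. These images are dense, as
  \<open>in_closed_if_words\<close> shows for the free profinite monoid.\<close>

definition pro_word :: "('a list set monoid \<Rightarrow> bool) \<Rightarrow> 'a set \<Rightarrow> 'a list \<Rightarrow> 'a pseudoword" where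
  "pro_word V A x = (\<lambda>\<theta>\<in>pro_index V A. \<theta> `` {x})"

lemma pro_letter_eq_word: "pro_letter V A a = pro_word V A [a]"
  by (simp add: pro_letter_def pro_word_def)

lemma pro_word_coord [simp]: "\<theta> \<in> pro_index V A \<Longrightarrow> pro_word V A x \<theta> = \<theta> `` {x}"
  by (simp add: pro_word_def)

lemma pro_word_carrier: "x \<in> lists A \<Longrightarrow> pro_word V A x \<in> pro_carrier V A"
  by (auto simp: pro_word_def pro_carrier_def quotientI)

lemma pro_word_append:
  assumes "x \<in> lists A" "y \<in> lists A"
  shows "pro_word V A (x @ y) = pro_word V A x \<otimes>\<^bsub>pro_monoid V A\<^esub> pro_word V A y"
proof -
  have "\<theta> `` {x @ y} = quot_mult \<theta> (\<theta> `` {x}) (\<theta> `` {y})" if "\<theta> \<in> pro_index V A" for \<theta>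
    using that quot_mult_class[OF _ assms] by (simp add: pro_index_iff)
  then show ?thesis
    unfolding pro_word_def[of V A "x @ y"] by (simp add: pro_monoid_def cong: restrict_cong)
qed

section \<open>The topology of the limit\<close>

lemma topspace_pro_top [simp]: "topspace (pro_top V A) = pro_carrier V A"
  by (auto simp: pro_top_def pro_carrier_def)

lemma continuous_coord:
  assumes "\<theta> \<in> pro_index V A"
  shows "continuous_map (pro_top V A) (discrete_topology (lists A // \<theta>)) (\<lambda>w. w \<theta>)"
  unfolding pro_top_def using assms
  by (intro continuous_map_from_subtopology continuous_map_product_projection)

text \<open>A basic neighbourhood of \<open>w\<close> constrains finitely many coordinates. A
  congruence finer than all of these controls them at once, so approximation in one coordinate at a
  time suffices.\<close>

lemma in_closed_if_coordinatewise:
  assumes S: "closedin (pw_top A) S" and w: "w \<in> pro_carrier finite_monoid A"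
    and approx: "\<And>\<theta>. \<theta> \<in> pro_index finite_monoid A \<Longrightarrow> \<exists>v\<in>S. v \<theta> = w \<theta>"
  shows "w \<in> S"
proof (rule ccontr)
  let ?I = "pro_index finite_monoid A"
  assume "w \<notin> S"
  have SC: "S \<subseteq> pro_carrier finite_monoid A"
    using closedin_subset[OF S] by simp
  have "openin (pw_top A) (pro_carrier finite_monoid A - S)"
    using S by (simp add: closedin_def)
  then obtain T where T: "openin (product_topology (\<lambda>\<theta>. discrete_topology (lists A // \<theta>)) ?I) T"
    and TS: "pro_carrier finite_monoid A - S = T \<inter> pro_carrier finite_monoid A"
    by (auto simp: pro_top_def openin_subtopology)
  have "w \<in> T" using w \<open>w \<notin> S\<close> TS by blast
  then obtain V where fin: "finite {\<theta> \<in> ?I. V \<theta> \<noteq> lists A // \<theta>}"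
    and V: "w \<in> Pi\<^sub>E ?I V" "Pi\<^sub>E ?I V \<subseteq> T"
    using T by (fastforce simp: openin_product_topology_alt)
  obtain \<theta>0 where \<theta>0: "\<theta>0 \<in> ?I" "\<And>\<theta>. \<theta> \<in> ?I \<Longrightarrow> V \<theta> \<noteq> lists A // \<theta> \<Longrightarrow> \<theta>0 \<subseteq> \<theta>"
    using pro_index_Inter_bound[OF fin] by blast
  obtain v where v: "v \<in> S" "v \<theta>0 = w \<theta>0"
    using approx[OF \<theta>0(1)] by blast
  have vC: "v \<in> pro_carrier finite_monoid A" using v SC by blast
  have "v \<theta> \<in> V \<theta>" if \<theta>: "\<theta> \<in> ?I" for \<theta>
  proof (cases "V \<theta> = lists A // \<theta>")
    case True
    then show ?thesis using pro_carrier_coord[OF vC \<theta>] by simp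
  next
    case False
    then have "v \<theta> = w \<theta>"
      using pro_carrier_coarser[OF vC w \<theta>0(1) \<theta>] \<theta>0(2)[OF \<theta>] v(2) by blast
    then show ?thesis using V(1) \<theta> by auto
  qed
  moreover have "v \<in> extensional ?I"
    using vC by (simp add: pro_carrier_def PiE_iff)
  ultimately have "v \<in> T"
    using V(2) unfolding PiE_def by blast
  then show False using TS vC v(1) by blast
qed

lemma in_closed_if_words:
  assumes S: "closedin (pw_top A) S" and words: "\<And>x. x \<in> lists A \<Longrightarrow> pro_word finite_monoid A x \<in> S"
    and w: "w \<in> pro_carrier finite_monoid A"
  shows "w \<in> S"
proof (rule in_closed_if_coordinatewise[OF S w])
  fix \<theta> assume \<theta>: "\<theta> \<in> pro_index finite_monoid A"
  obtain x where "x \<in> lists A" "w \<theta> = \<theta> `` {x}"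
    using pro_carrier_coord[OF w \<theta>] by (rule quotientE)
  then show "\<exists>v\<in>S. v \<theta> = w \<theta>"
    using words \<theta> by (intro bexI[of _ "pro_word finite_monoid A x"]) auto
qed

lemma closedin_coord_preimage:
  assumes "\<theta> \<in> pro_index V A"
  shows "closedin (pro_top V A) {w \<in> pro_carrier V A. w \<theta> \<in> T}"
proof -
  have "closedin (pro_top V A) {w \<in> topspace (pro_top V A). w \<theta> \<in> T \<inter> (lists A // \<theta>)}"
    by (rule closedin_continuous_map_preimage[OF continuous_coord[OF assms]]) simp
  moreover have "{w \<in> topspace (pro_top V A). w \<theta> \<in> T \<inter> (lists A // \<theta>)} = {w \<in> pro_carrier V A. w \<theta> \<in> T}"
    using assms by (auto simp: pro_carrier_coord)
  ultimately show ?thesis by simp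
qed

section \<open>Existence and uniqueness of the omega power\<close>

lemma closed_subsemigroup_genD:
  assumes "e \<in> closed_subsemigroup_gen M T s"
    and "closedin T S" "S \<subseteq> carrier M" "\<And>x y. x \<in> S \<Longrightarrow> y \<in> S \<Longrightarrow> x \<otimes>\<^bsub>M\<^esub> y \<in> S" "s \<in> S"
  shows "e \<in> S"
  using assms by (simp add: closed_subsemigroup_gen_def)

lemma closed_subsemigroup_gen_carrier:
  assumes "e \<in> closed_subsemigroup_gen (pw_monoid A) (pw_top A) s" "s \<in> pro_carrier finite_monoid A"
  shows "e \<in> pro_carrier finite_monoid A"
  using assms(2) closedin_topspace[of "pw_top A"]
    monoid.m_closed[OF monoid_pro_monoid[of finite_monoid A]]
  by (intro closed_subsemigroup_genD[OF assms(1)]) simp_all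

lemma closed_subsemigroup_genI:
  assumes s: "s \<in> pro_carrier finite_monoid A" and e: "e \<in> pro_carrier finite_monoid A"
    and powers: "\<And>\<theta>. \<theta> \<in> pro_index finite_monoid A \<Longrightarrow> \<exists>m>0. e \<theta> = (s [^]\<^bsub>pw_monoid A\<^esub> (m::nat)) \<theta>"
  shows "e \<in> closed_subsemigroup_gen (pw_monoid A) (pw_top A) s"
  unfolding closed_subsemigroup_gen_def
proof (intro InterI, clarify)
  interpret monoid "pw_monoid A" by (rule monoid_pro_monoid)
  fix S
  assume S: "closedin (pw_top A) S" "\<forall>x\<in>S. \<forall>y\<in>S. x \<otimes>\<^bsub>pw_monoid A\<^esub> y \<in> S" "s \<in> S"
  have "s [^]\<^bsub>pw_monoid A\<^esub> m \<in> S" if "0 < m" for m :: nat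
    using that S s by (induction m rule: nat_induct_non_zero) simp_all
  then show "e \<in> S"
    using in_closed_if_coordinatewise[OF S(1) e] powers by metis
qed

text \<open>The pseudowords whose coordinate at \<open>\<theta>\<close> is a positive power of that
  of \<open>s\<close> form a closed subsemigroup containing \<open>s\<close>.\<close>

lemma closed_subsemigroup_gen_coord:
  assumes e: "e \<in> closed_subsemigroup_gen (pw_monoid A) (pw_top A) s"
    and s: "s \<in> pro_carrier finite_monoid A" and \<theta>: "\<theta> \<in> pro_index finite_monoid A"
  shows "\<exists>m>0. e \<theta> = s \<theta> [^]\<^bsub>quot_monoid A \<theta>\<^esub> (m::nat)"
proof -
  interpret P: monoid "pw_monoid A" by (rule monoid_pro_monoid)
  interpret Q: monoid "quot_monoid A \<theta>" by (rule quot_monoid_pro_index[OF \<theta>])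
  let ?S = "{w \<in> pro_carrier finite_monoid A. w \<theta> \<in> {s \<theta> [^]\<^bsub>quot_monoid A \<theta>\<^esub> m |m::nat. 0 < m}}"
  have "s \<in> ?S"
    using s Q.nat_pow_0 Q.l_one pro_carrier_coord[OF s \<theta>]
    by (auto intro!: exI[of _ "1::nat"])
  moreover have "x \<otimes>\<^bsub>pw_monoid A\<^esub> y \<in> ?S" if "x \<in> ?S" "y \<in> ?S" for x y
  proof -
    obtain i :: nat where i: "x \<theta> = s \<theta> [^]\<^bsub>quot_monoid A \<theta>\<^esub> i" "0 < i"
      using \<open>x \<in> ?S\<close> by auto
    obtain j :: nat where j: "y \<theta> = s \<theta> [^]\<^bsub>quot_monoid A \<theta>\<^esub> j"
      using \<open>y \<in> ?S\<close> by auto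
    have "(x \<otimes>\<^bsub>pw_monoid A\<^esub> y) \<theta> = s \<theta> [^]\<^bsub>quot_monoid A \<theta>\<^esub> (i + j)"
      using Q.nat_pow_mult[of "s \<theta>" i j] pro_carrier_coord[OF s \<theta>] \<theta> by (simp add: i j)
    moreover have "x \<otimes>\<^bsub>pw_monoid A\<^esub> y \<in> pro_carrier finite_monoid A"
      using P.m_closed that by simp
    ultimately show ?thesis
      using i(2) by auto
  qed
  moreover have "?S \<subseteq> carrier (pw_monoid A)" by auto
  ultimately have "e \<in> ?S"
    by (intro closed_subsemigroup_genD[OF e closedin_coord_preimage[OF \<theta>]])
  then show ?thesis by blast
qed

text \<open>In each finite quotient the coordinate of \<open>s\<close> has exactly one idempotent
  positive power. These powers are assembled into \<open>e\<close>, and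
  \<open>closed_subsemigroup_gen_coord\<close> leaves no other choice.\<close>

lemma ex1_pw_omega:
  assumes s: "s \<in> pro_carrier finite_monoid A"
  shows "\<exists>!e. e \<in> closed_subsemigroup_gen (pw_monoid A) (pw_top A) s \<and> e \<otimes>\<^bsub>pw_monoid A\<^esub> e = e"
proof -
  let ?I = "pro_index finite_monoid A" and ?Q = "quot_monoid A"
  interpret P: monoid "pw_monoid A" by (rule monoid_pro_monoid)
  have sQ: "s \<theta> \<in> carrier (?Q \<theta>)" "monoid (?Q \<theta>)" "finite (carrier (?Q \<theta>))" if "\<theta> \<in> ?I" for \<theta>
    using that pro_carrier_coord[OF s that] by (simp_all add: pro_index_iff monoid_quot_monoid)
  have "\<exists>m>0. s \<theta> [^]\<^bsub>?Q \<theta>\<^esub> (m::nat) \<otimes>\<^bsub>?Q \<theta>\<^esub> s \<theta> [^]\<^bsub>?Q \<theta>\<^esub> m = s \<theta> [^]\<^bsub>?Q \<theta>\<^esub> m" if "\<theta> \<in> ?I" for \<theta>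
    using monoid.ex_idempotent_power[of "?Q \<theta>"] sQ[OF that] by blast
  then obtain m :: "_ \<Rightarrow> nat" where m: "\<And>\<theta>. \<theta> \<in> ?I \<Longrightarrow> 0 < m \<theta>"
    "\<And>\<theta>. \<theta> \<in> ?I \<Longrightarrow> s \<theta> [^]\<^bsub>?Q \<theta>\<^esub> m \<theta> \<otimes>\<^bsub>?Q \<theta>\<^esub> s \<theta> [^]\<^bsub>?Q \<theta>\<^esub> m \<theta> = s \<theta> [^]\<^bsub>?Q \<theta>\<^esub> m \<theta>"
    by metis
  define e where "e = (\<lambda>\<theta>\<in>?I. s \<theta> [^]\<^bsub>?Q \<theta>\<^esub> m \<theta>)"
  have pow: "s [^]\<^bsub>pw_monoid A\<^esub> j \<in> pro_carrier finite_monoid A" for j :: nat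
    using P.nat_pow_closed s by simp
  have e_coord: "e \<theta> = (s [^]\<^bsub>pw_monoid A\<^esub> m \<theta>) \<theta>" if "\<theta> \<in> ?I" for \<theta>
    using that by (simp add: e_def pro_pow_coord)
  \<comment> \<open>An exponent that is idempotent at \<open>\<theta>\<close> stays so at the
    coarser \<open>\<theta>'\<close>, and idempotent powers are unique there. This is the
    compatibility of the family \<open>e\<close>.\<close>
  have e_coarser: "e \<theta>' = (s [^]\<^bsub>pw_monoid A\<^esub> m \<theta>) \<theta>'"
    if \<theta>: "\<theta> \<in> ?I" and \<theta>': "\<theta>' \<in> ?I" and "\<theta> \<subseteq> \<theta>'" for \<theta> \<theta>'
  proof -
    have "(s [^]\<^bsub>pw_monoid A\<^esub> m \<theta> \<otimes>\<^bsub>pw_monoid A\<^esub> s [^]\<^bsub>pw_monoid A\<^esub> m \<theta>) \<theta>' = (s [^]\<^bsub>pw_monoid A\<^esub> m \<theta>) \<theta>'"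
    proof (rule pro_carrier_coarser[OF _ pow \<theta> \<theta>' \<open>\<theta> \<subseteq> \<theta>'\<close>])
      show "s [^]\<^bsub>pw_monoid A\<^esub> m \<theta> \<otimes>\<^bsub>pw_monoid A\<^esub> s [^]\<^bsub>pw_monoid A\<^esub> m \<theta> \<in> pro_carrier finite_monoid A"
        using P.m_closed pow by simp
    qed (use m(2)[OF \<theta>] \<theta> in \<open>simp add: pro_pow_coord\<close>)
    then have "s \<theta>' [^]\<^bsub>?Q \<theta>'\<^esub> m \<theta> = s \<theta>' [^]\<^bsub>?Q \<theta>'\<^esub> m \<theta>'"
      using m \<theta> \<theta>' sQ[OF \<theta>']
      by (intro monoid.idempotent_power_unique[of "?Q \<theta>'"]) (simp_all add: pro_pow_coord)
    then show ?thesis using \<theta>' by (simp add: e_coord pro_pow_coord)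
  qed
  have eC: "e \<in> pro_carrier finite_monoid A"
  proof -
    have "e \<theta> \<in> lists A // \<theta>" if "\<theta> \<in> ?I" for \<theta>
      using pro_carrier_coord[OF pow that] e_coord[OF that] by simp
    moreover have "e \<theta> \<subseteq> e \<theta>'" if "\<theta> \<in> ?I" "\<theta>' \<in> ?I" "\<theta> \<subseteq> \<theta>'" for \<theta> \<theta>'
      using pow[of "m \<theta>"] that e_coord[OF that(1)] e_coarser[OF that] by (simp add: pro_carrier_def)
    moreover have "e \<in> extensional ?I" by (simp add: e_def)
    ultimately show ?thesis by (simp add: pro_carrier_def PiE_iff)
  qed
  show ?thesis
  proof (rule ex1I[of _ e], intro conjI)
    show "e \<in> closed_subsemigroup_gen (pw_monoid A) (pw_top A) s"
      using m(1) e_coord by (intro closed_subsemigroup_genI s eC) blast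
    show "e \<otimes>\<^bsub>pw_monoid A\<^esub> e = e"
      using P.m_closed eC m(2) by (intro pro_carrier_eqI[of _ finite_monoid A]) (simp_all add: e_def)
  next
    fix e' assume e': "e' \<in> closed_subsemigroup_gen (pw_monoid A) (pw_top A) s \<and> e' \<otimes>\<^bsub>pw_monoid A\<^esub> e' = e'"
    then have e'C: "e' \<in> pro_carrier finite_monoid A"
      using s closed_subsemigroup_gen_carrier by blast
    show "e' = e"
    proof (rule pro_carrier_eqI[OF e'C eC])
      fix \<theta> assume \<theta>: "\<theta> \<in> ?I"
      obtain j :: nat where j: "0 < j" "e' \<theta> = s \<theta> [^]\<^bsub>?Q \<theta>\<^esub> j"
        using closed_subsemigroup_gen_coord[OF conjunct1[OF e'] s \<theta>] by blast
      have "quot_mult \<theta> (e' \<theta>) (e' \<theta>) = e' \<theta>"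
        using arg_cong[OF conjunct2[OF e'], of "\<lambda>w. w \<theta>"] \<theta> by simp
      then show "e' \<theta> = e \<theta>"
        using monoid.idempotent_power_unique[OF sQ(2,1)[OF \<theta>] j(1) m(1)[OF \<theta>]] m(2)[OF \<theta>] \<theta>
        by (simp add: j(2) e_def)
    qed
  qed
qed

lemma pw_omega:
  assumes "s \<in> pro_carrier finite_monoid A"
  shows "pw_omega A s \<in> closed_subsemigroup_gen (pw_monoid A) (pw_top A) s"
    and "pw_omega A s \<otimes>\<^bsub>pw_monoid A\<^esub> pw_omega A s = pw_omega A s"
  using theI'[OF ex1_pw_omega[OF assms]] by (simp_all add: omega_pow_def)

lemma pw_omega_closed:
  assumes "s \<in> pro_carrier finite_monoid A"
  shows "pw_omega A s \<in> pro_carrier finite_monoid A"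
  using closed_subsemigroup_gen_carrier[OF pw_omega(1)[OF assms] assms] .

subsection \<open>Continuous homomorphisms into finite monoids\<close>

definition word_kernel :: "'a set \<Rightarrow> ('a list \<Rightarrow> 'b) \<Rightarrow> 'a list rel" where
  "word_kernel A h = {(x, y). x \<in> lists A \<and> y \<in> lists A \<and> h x = h y}"

locale word_hom =
  fixes A :: "'a set" and F :: "'b monoid" and h :: "'a list \<Rightarrow> 'b"
  assumes finite_target: "finite_monoid F"
    and h_closed: "x \<in> lists A \<Longrightarrow> h x \<in> carrier F"
    and h_append: "\<lbrakk>x \<in> lists A; y \<in> lists A\<rbrakk> \<Longrightarrow> h (x @ y) = h x \<otimes>\<^bsub>F\<^esub> h y"
    and h_Nil: "h [] = \<one>\<^bsub>F\<^esub>"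
begin

abbreviation (input) ker :: "'a list rel" where
  "ker \<equiv> word_kernel A h"

lemma kernel_class: "x \<in> lists A \<Longrightarrow> ker `` {x} = {y \<in> lists A. h y = h x}"
  by (auto simp: word_kernel_def)

lemma kernel_index: "ker \<in> pro_index finite_monoid A"
proof -
  have "word_congruence A ker"
    unfolding word_congruence_def
  proof (intro conjI)
    show "equiv (lists A) ker"
      by (rule equivI) (auto simp: word_kernel_def refl_on_def sym_def trans_def)
  qed (auto simp: word_kernel_def h_append[unfolded in_lists_conv_set])
  moreover have "lists A // ker \<subseteq> (\<lambda>b. {y \<in> lists A. h y = b}) ` carrier F"
  proof
    fix X assume "X \<in> lists A // ker"
    then obtain x where "x \<in> lists A" "X = ker `` {x}"
      by (rule quotientE)
    then show "X \<in> (\<lambda>b. {y \<in> lists A. h y = b}) ` carrier F"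
      using kernel_class h_closed by blast
  qed
  from finite_subset[OF this finite_imageI] have "finite (lists A // ker)"
    using finite_target by (simp add: finite_monoid_def)
  ultimately show ?thesis
    by (simp add: pro_index_finite_iff)
qed

lemma ex_kernel_embedding:
  "\<exists>\<psi>\<in>monoid_hom (quot_monoid A ker) F. inj_on \<psi> (lists A // ker) \<and> (\<forall>x\<in>lists A. \<psi> (ker `` {x}) = h x)"
proof -
  have wc: "word_congruence A ker"
    using kernel_index by (simp add: pro_index_finite_iff)
  \<comment> \<open>Any representative will do, since \<open>h\<close> is constant on the classes of
    its kernel.\<close>
  define \<psi> where "\<psi> X = h (SOME x. x \<in> X)" for X
  have \<psi>: "\<psi> (ker `` {x}) = h x" if "x \<in> lists A" for x
    using someI[of "\<lambda>y. y \<in> ker `` {x}" x] that unfolding \<psi>_def kernel_class[OF that] by blast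
  have "\<psi> \<in> hom (quot_monoid A ker) F"
  proof (rule homI)
    fix X assume "X \<in> carrier (quot_monoid A ker)"
    then show "\<psi> X \<in> carrier F"
      unfolding quot_monoid_simps by (rule quotientE) (simp add: \<psi> h_closed)
  next
    fix X Y assume "X \<in> carrier (quot_monoid A ker)" "Y \<in> carrier (quot_monoid A ker)"
    then obtain x y where "x \<in> lists A" "y \<in> lists A" "X = ker `` {x}" "Y = ker `` {y}"
      unfolding quot_monoid_simps by (meson quotientE)
    then show "\<psi> (X \<otimes>\<^bsub>quot_monoid A ker\<^esub> Y) = \<psi> X \<otimes>\<^bsub>F\<^esub> \<psi> Y"
      by (simp add: \<psi> h_append quot_mult_class[OF wc])
  qed
  moreover have "\<psi> (ker `` {[]}) = \<one>\<^bsub>F\<^esub>"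
    by (simp add: \<psi> h_Nil)
  moreover have "inj_on \<psi> (lists A // ker)"
  proof (rule inj_onI)
    fix X Y assume "X \<in> lists A // ker" "Y \<in> lists A // ker" "\<psi> X = \<psi> Y"
    moreover from this obtain x y
      where "x \<in> lists A" "y \<in> lists A" "X = ker `` {x}" "Y = ker `` {y}"
      by (meson quotientE)
    ultimately have "h x = h y"
      using \<psi> by simp
    then show "X = Y"
      using kernel_class \<open>x \<in> lists A\<close> \<open>y \<in> lists A\<close> \<open>X = ker `` {x}\<close> \<open>Y = ker `` {y}\<close> by simp
  qed
  ultimately show ?thesis
    using \<psi> by (intro bexI[of _ \<psi>]) (auto simp: monoid_hom_def)
qed

end

section \<open>Continuous homomorphisms and their factorization\<close>

lemma monoid_hom_comp:
  assumes "f \<in> monoid_hom M N" "g \<in> monoid_hom N P"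
  shows "g \<circ> f \<in> monoid_hom M P"
  using assms by (auto simp: monoid_hom_def hom_def Pi_iff)

lemma coord_monoid_hom:
  assumes "\<theta> \<in> pro_index V A"
  shows "(\<lambda>w. w \<theta>) \<in> monoid_hom (pro_monoid V A) (quot_monoid A \<theta>)"
  using assms by (auto simp: monoid_hom_def hom_def pro_carrier_coord)

locale continuous_hom =
  fixes A :: "'a set" and F :: "'b monoid" and \<phi> :: "'a pseudoword \<Rightarrow> 'b"
  assumes finite_target: "finite_monoid F"
    and hom: "\<phi> \<in> monoid_hom (pw_monoid A) F"
    and continuous: "continuous_map (pw_top A) (discrete_topology (carrier F)) \<phi>"

text \<open>Evaluating words through \<open>g\<close> is a homomorphism on \<open>lists A\<close>
  whose kernel is an index; the projection to that coordinate followed by the induced embedding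
  extends \<open>g\<close>. It is used to substitute elements for the letters of the defining
  pseudoidentities.\<close>

lemma ex_continuous_hom:
  assumes F: "finite_monoid F" and g: "\<And>a. a \<in> A \<Longrightarrow> g a \<in> carrier F"
  shows "\<exists>\<phi>. continuous_hom A F \<phi> \<and> (\<forall>a\<in>A. \<phi> (pw_letter A a) = g a)"
proof -
  interpret monoid F using F by (simp add: finite_monoid_def)
  have closed: "foldr (\<lambda>a r. g a \<otimes>\<^bsub>F\<^esub> r) x \<one>\<^bsub>F\<^esub> \<in> carrier F" if "x \<in> lists A" for x
    using that by (induction x) (simp_all add: g)
  interpret word_hom A F "\<lambda>x. foldr (\<lambda>a r. g a \<otimes>\<^bsub>F\<^esub> r) x \<one>\<^bsub>F\<^esub>"
  proof
    fix x y assume "x \<in> lists A" "y \<in> lists A"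
    then show "foldr (\<lambda>a r. g a \<otimes>\<^bsub>F\<^esub> r) (x @ y) \<one>\<^bsub>F\<^esub>
        = foldr (\<lambda>a r. g a \<otimes>\<^bsub>F\<^esub> r) x \<one>\<^bsub>F\<^esub> \<otimes>\<^bsub>F\<^esub> foldr (\<lambda>a r. g a \<otimes>\<^bsub>F\<^esub> r) y \<one>\<^bsub>F\<^esub>"
      using closed by (induction x) (simp_all add: m_assoc g)
  qed (use F closed in auto)
  obtain \<psi> where \<psi>: "\<psi> \<in> monoid_hom (quot_monoid A ker) F"
    "\<And>x. x \<in> lists A \<Longrightarrow> \<psi> (ker `` {x}) = foldr (\<lambda>a r. g a \<otimes>\<^bsub>F\<^esub> r) x \<one>\<^bsub>F\<^esub>"
    using ex_kernel_embedding by blast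
  have "\<psi> ` (lists A // ker) \<subseteq> carrier F"
    using \<psi>(1) by (auto simp: monoid_hom_def hom_def)
  then have "continuous_map (pw_top A) (discrete_topology (carrier F)) (\<psi> \<circ> (\<lambda>w. w ker))"
    by (intro continuous_map_compose[OF continuous_coord[OF kernel_index]]) auto
  then have "continuous_hom A F (\<psi> \<circ> (\<lambda>w. w ker))"
    using F monoid_hom_comp[OF coord_monoid_hom[OF kernel_index] \<psi>(1)]
    by unfold_locales
  moreover have "(\<psi> \<circ> (\<lambda>w. w ker)) (pw_letter A a) = g a" if "a \<in> A" for a
    using that \<psi>(2)[of "[a]"] g kernel_index by (simp add: pro_letter_eq_word)
  ultimately show ?thesis by blast
qed

context continuous_hom
begin

sublocale F: monoid F
  using finite_target by (simp add: finite_monoid_def)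

lemma map_closed: "w \<in> pro_carrier finite_monoid A \<Longrightarrow> \<phi> w \<in> carrier F"
  using hom by (auto simp: monoid_hom_def hom_def)

lemma map_mult:
  "\<lbrakk>u \<in> pro_carrier finite_monoid A; v \<in> pro_carrier finite_monoid A\<rbrakk> \<Longrightarrow> \<phi> (u \<otimes>\<^bsub>pw_monoid A\<^esub> v) = \<phi> u \<otimes>\<^bsub>F\<^esub> \<phi> v"
  using hom by (auto simp: monoid_hom_def hom_def)

lemma map_one: "\<phi> \<one>\<^bsub>pw_monoid A\<^esub> = \<one>\<^bsub>F\<^esub>"
  using hom by (auto simp: monoid_hom_def)

lemma map_pow:
  "u \<in> pro_carrier finite_monoid A \<Longrightarrow> \<phi> (u [^]\<^bsub>pw_monoid A\<^esub> (j::nat)) = \<phi> u [^]\<^bsub>F\<^esub> j"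
  by (induction j) (simp_all add: map_one map_mult pw_pow_closed)

lemma closedin_preimage: "closedin (pw_top A) {w \<in> pro_carrier finite_monoid A. \<phi> w \<in> T}"
proof -
  have "closedin (pw_top A) {w \<in> topspace (pw_top A). \<phi> w \<in> T \<inter> carrier F}"
    by (rule closedin_continuous_map_preimage[OF continuous]) simp
  moreover have "{w \<in> topspace (pw_top A). \<phi> w \<in> T \<inter> carrier F} = {w \<in> pro_carrier finite_monoid A. \<phi> w \<in> T}"
    by (auto simp: map_closed)
  ultimately show ?thesis by simp
qed

text \<open>The preimage of the positive powers of the image of \<open>s\<close> is a closed
  subsemigroup containing \<open>s\<close>. So the omega power maps to an idempotent positive power,
  of which there is only one.\<close>

lemma map_omega:
  assumes s: "s \<in> pro_carrier finite_monoid A"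
    and k: "0 < (k::nat)" "\<phi> s [^]\<^bsub>F\<^esub> k \<otimes>\<^bsub>F\<^esub> \<phi> s [^]\<^bsub>F\<^esub> k = \<phi> s [^]\<^bsub>F\<^esub> k"
  shows "\<phi> (pw_omega A s) = \<phi> s [^]\<^bsub>F\<^esub> k"
proof -
  let ?S = "{w \<in> pro_carrier finite_monoid A. \<phi> w \<in> {\<phi> s [^]\<^bsub>F\<^esub> m |m::nat. 0 < m}}"
  have "s \<in> ?S"
    using s map_closed[OF s] by (auto intro!: exI[of _ "1::nat"])
  moreover have "x \<otimes>\<^bsub>pw_monoid A\<^esub> y \<in> ?S" if "x \<in> ?S" "y \<in> ?S" for x y
  proof -
    obtain i :: nat where "\<phi> x = \<phi> s [^]\<^bsub>F\<^esub> i" "0 < i"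
      using \<open>x \<in> ?S\<close> by auto
    moreover obtain j :: nat where "\<phi> y = \<phi> s [^]\<^bsub>F\<^esub> j"
      using \<open>y \<in> ?S\<close> by auto
    ultimately have "\<phi> (x \<otimes>\<^bsub>pw_monoid A\<^esub> y) = \<phi> s [^]\<^bsub>F\<^esub> (i + j)" "0 < i + j"
      using that map_closed[OF s] by (simp_all add: map_mult F.nat_pow_mult)
    then show ?thesis
      using that pw_mult_closed by blast
  qed
  moreover have "?S \<subseteq> carrier (pw_monoid A)" by auto
  ultimately have "pw_omega A s \<in> ?S"
    by (intro closed_subsemigroup_genD[OF pw_omega(1)[OF s] closedin_preimage])
  then obtain m :: nat where m: "0 < m" "\<phi> (pw_omega A s) = \<phi> s [^]\<^bsub>F\<^esub> m"
    by blast
  have "\<phi> (pw_omega A s) \<otimes>\<^bsub>F\<^esub> \<phi> (pw_omega A s) = \<phi> (pw_omega A s)"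
    using pw_omega[OF s] pw_omega_closed[OF s] map_mult by metis
  then show ?thesis
    using F.idempotent_power_unique[OF map_closed[OF s] m(1) k(1) _ k(2)] m(2) by simp
qed

lemma word_hom: "word_hom A F (\<lambda>x. \<phi> (pro_word finite_monoid A x))"
proof
  have "pro_word finite_monoid A [] = \<one>\<^bsub>pw_monoid A\<^esub>"
    by (simp add: pro_word_def pro_monoid_def)
  then show "\<phi> (pro_word finite_monoid A []) = \<one>\<^bsub>F\<^esub>"
    by (simp add: map_one)
qed (use finite_target in \<open>simp_all add: map_closed map_mult pro_word_carrier pro_word_append\<close>)

text \<open>The index is the kernel of \<open>\<phi>\<close> on words. Both sides of the
  factorization agree on words, and the set where they agree is closed, so density extends the
  equality to all pseudowords.\<close>

lemma factors_through_index:
  "\<exists>\<theta>\<in>pro_index finite_monoid A. \<exists>\<psi>\<in>monoid_hom (quot_monoid A \<theta>) F.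
     inj_on \<psi> (lists A // \<theta>) \<and> (\<forall>w\<in>pro_carrier finite_monoid A. \<phi> w = \<psi> (w \<theta>))"
proof -
  interpret W: word_hom A F "\<lambda>x. \<phi> (pro_word finite_monoid A x)" by (rule word_hom)
  obtain \<psi> where \<psi>: "\<psi> \<in> monoid_hom (quot_monoid A W.ker) F" "inj_on \<psi> (lists A // W.ker)"
    "\<And>x. x \<in> lists A \<Longrightarrow> \<psi> (W.ker `` {x}) = \<phi> (pro_word finite_monoid A x)"
    using W.ex_kernel_embedding by blast
  have "\<phi> w = \<psi> (w W.ker)" if w: "w \<in> pro_carrier finite_monoid A" for w
  proof -
    \<comment> \<open>The set of agreement is split by the common value \<open>b\<close>, which
      exhibits it as a finite union of closed sets.\<close>
    let ?S = "\<lambda>b. {w \<in> pro_carrier finite_monoid A. \<phi> w \<in> {b}} \<inter>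
      {w \<in> pro_carrier finite_monoid A. w W.ker \<in> {X. \<psi> X = b}}"
    have "closedin (pw_top A) (?S b)" for b
      by (rule closedin_Int[OF closedin_preimage closedin_coord_preimage[OF W.kernel_index]])
    then have "closedin (pw_top A) (\<Union>b\<in>carrier F. ?S b)"
      using finite_target by (intro closedin_Union) (auto simp: finite_monoid_def)
    moreover have "pro_word finite_monoid A x \<in> (\<Union>b\<in>carrier F. ?S b)" if "x \<in> lists A" for x
    proof (rule UN_I)
      show "\<phi> (pro_word finite_monoid A x) \<in> carrier F"
        using pro_word_carrier[OF that] map_closed by blast
      show "pro_word finite_monoid A x \<in> ?S (\<phi> (pro_word finite_monoid A x))"
        using W.kernel_index \<psi>(3)[OF that] pro_word_carrier[OF that] by simp
    qed
    ultimately have "w \<in> (\<Union>b\<in>carrier F. ?S b)"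
      using w by (rule in_closed_if_words)
    then show ?thesis by auto
  qed
  then show ?thesis
    using \<psi>(1,2) W.kernel_index by blast
qed

end

section \<open>Satisfaction and membership in the pseudovariety\<close>

lemma satisfies_iff:
  assumes "finite_monoid F"
  shows "satisfies F A u v \<longleftrightarrow> (\<forall>\<phi>. continuous_hom A F \<phi> \<longrightarrow> \<phi> u = \<phi> v)"
  using assms by (auto simp: satisfies_def continuous_hom_def)

lemma satisfies_embedding:
  assumes \<psi>: "\<psi> \<in> monoid_hom Q F" "inj_on \<psi> (carrier Q)" and Q: "finite_monoid Q" and F: "finite_monoid F"
    and u: "u \<in> pro_carrier finite_monoid A" and v: "v \<in> pro_carrier finite_monoid A"
    and sat: "satisfies F A u v"
  shows "satisfies Q A u v"
  unfolding satisfies_iff[OF Q]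
proof (intro allI impI)
  fix \<phi> assume "continuous_hom A Q \<phi>"
  then interpret continuous_hom A Q \<phi> .
  have "\<psi> ` carrier Q \<subseteq> carrier F"
    using \<psi>(1) by (auto simp: monoid_hom_def hom_def)
  then have "continuous_map (pw_top A) (discrete_topology (carrier F)) (\<psi> \<circ> \<phi>)"
    by (intro continuous_map_compose[OF continuous]) auto
  then have "continuous_hom A F (\<psi> \<circ> \<phi>)"
    using F monoid_hom_comp[OF hom \<psi>(1)] by unfold_locales
  then have "\<psi> (\<phi> u) = \<psi> (\<phi> v)"
    using sat by (auto simp: satisfies_iff[OF F])
  then show "\<phi> u = \<phi> v"
    using \<psi>(2) map_closed u v by (auto dest: inj_onD)
qed

lemma pw_letter_closed: "a \<in> A \<Longrightarrow> pw_letter A a \<in> pro_carrier finite_monoid A"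
  by (simp add: pro_letter_eq_word pro_word_carrier)

text \<open>Membership passes to embedded monoids because an injective homomorphism reflects each
  defining pseudoidentity. It places the quotient through which a homomorphism factors among the
  indices of \<open>BGn n\<close>.\<close>

lemma BGn_embedding:
  assumes \<psi>: "\<psi> \<in> monoid_hom Q F" "inj_on \<psi> (carrier Q)" and Q: "finite_monoid Q" and F: "BGn n F"
  shows "BGn n Q"
proof -
  have "finite_monoid F" using F by (simp add: BGn_def BG_def)
  note sat = satisfies_embedding[OF \<psi> Q this]
  show ?thesis
    using F Q unfolding BGn_def BG_def Let_def
    by (auto intro!: sat pw_mult_closed pw_omega_closed pw_letter_closed pw_pow_closed)
qed

text \<open>The letters are sent to the given elements by \<open>ex_continuous_hom\<close>, and
  \<open>map_omega\<close> turns every omega into the exponent \<open>k\<close>.\<close>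

lemma BGn_bg_exponent:
  assumes F: "BGn n F" and k: "0 < k" "\<forall>x\<in>carrier F. x [^]\<^bsub>F\<^esub> k \<otimes>\<^bsub>F\<^esub> x [^]\<^bsub>F\<^esub> k = x [^]\<^bsub>F\<^esub> k"
  shows "bg_exponent F n k"
proof -
  have fin: "finite_monoid F" using F by (simp add: BGn_def BG_def)
  then interpret M: monoid F by (simp add: finite_monoid_def)
  show ?thesis
  proof (unfold_locales, goal_cases)
    case (3 x y)
    let ?X = "{0, 1::nat}"
    have "\<exists>\<phi>. continuous_hom ?X F \<phi> \<and> (\<forall>a\<in>?X. \<phi> (pw_letter ?X a) = (if a = 0 then x else y))"
      by (rule ex_continuous_hom[OF fin]) (use 3 in auto)
    then obtain \<phi> where "continuous_hom ?X F \<phi>"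
      and \<phi>: "\<forall>a\<in>?X. \<phi> (pw_letter ?X a) = (if a = 0 then x else y)"
      by blast
    then interpret continuous_hom ?X F \<phi> by blast
    let ?x = "pw_letter ?X 0" and ?y = "pw_letter ?X 1"
    have [simp]: "?x \<in> pro_carrier finite_monoid ?X" "?y \<in> pro_carrier finite_monoid ?X"
      by (simp_all add: pw_letter_closed)
    have [simp]: "\<phi> ?x = x" "\<phi> ?y = y" using \<phi> by auto
    have om: "\<phi> (pw_omega ?X s) = \<phi> s [^]\<^bsub>F\<^esub> k" if "s \<in> pro_carrier finite_monoid ?X" for s
      using map_omega[OF that k(1)] k(2) map_closed[OF that] by blast
    have "\<phi> (pw_omega ?X (pw_omega ?X ?x \<otimes>\<^bsub>pw_monoid ?X\<^esub> ?y)) = \<phi> (pw_omega ?X (?y \<otimes>\<^bsub>pw_monoid ?X\<^esub> pw_omega ?X ?x))"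
      using F \<open>continuous_hom ?X F \<phi>\<close> by (auto simp: BGn_def BG_def Let_def satisfies_iff[OF fin])
    then show ?case
      by (simp only: om pw_mult_closed pw_omega_closed map_mult \<open>?x \<in> _\<close> \<open>?y \<in> _\<close> \<open>\<phi> ?x = x\<close> \<open>\<phi> ?y = y\<close>)
  next
    case (4 x y z)
    let ?X = "{0, 1, 2::nat}"
    let ?g = "\<lambda>a::nat. if a = 0 then x else if a = 1 then y else z"
    have "\<exists>\<phi>. continuous_hom ?X F \<phi> \<and> (\<forall>a\<in>?X. \<phi> (pw_letter ?X a) = ?g a)"
      by (rule ex_continuous_hom[OF fin]) (use 4 in auto)
    then obtain \<phi> where "continuous_hom ?X F \<phi>" and \<phi>: "\<forall>a\<in>?X. \<phi> (pw_letter ?X a) = ?g a"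
      by blast
    then interpret continuous_hom ?X F \<phi> by blast
    let ?x = "pw_letter ?X 0" and ?y = "pw_letter ?X 1" and ?z = "pw_letter ?X 2"
    have letters: "?x \<in> pro_carrier finite_monoid ?X" "?y \<in> pro_carrier finite_monoid ?X" "?z \<in> pro_carrier finite_monoid ?X"
      by (simp_all add: pw_letter_closed)
    have vals: "\<phi> ?x = x" "\<phi> ?y = y" "\<phi> ?z = z" using \<phi> by auto
    have om: "\<phi> (pw_omega ?X s) = \<phi> s [^]\<^bsub>F\<^esub> k" if "s \<in> pro_carrier finite_monoid ?X" for s
      using map_omega[OF that k(1)] k(2) map_closed[OF that] by blast
    have "\<phi> (pw_omega1 ?X (?x \<otimes>\<^bsub>pw_monoid ?X\<^esub> pw_omega ?X ?y \<otimes>\<^bsub>pw_monoid ?X\<^esub> ?z))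
        = \<phi> (pw_omega1 ?X (?x \<otimes>\<^bsub>pw_monoid ?X\<^esub> (?y [^]\<^bsub>pw_monoid ?X\<^esub> n) \<otimes>\<^bsub>pw_monoid ?X\<^esub> ?z))"
      using F \<open>continuous_hom ?X F \<phi>\<close> by (auto simp: BGn_def BG_def Let_def satisfies_iff[OF fin])
    then show ?case
      by (simp only: om pw_mult_closed pw_omega_closed pw_pow_closed map_mult map_pow letters vals)
  qed (use k in auto)
qed

section \<open>Provability stages under a continuous homomorphism\<close>

context continuous_hom
begin

text \<open>A product of two discrete spaces is discrete, so every relation on
  \<open>carrier F\<close> is closed.\<close>

lemma closedin_rel_preimage:
  "closedin (prod_topology (pw_top A) (pw_top A))
     {(u, v) \<in> pro_carrier finite_monoid A \<times> pro_carrier finite_monoid A. (\<phi> u, \<phi> v) \<in> R}"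
proof -
  let ?P = "prod_topology (pw_top A) (pw_top A)" and ?C = "pro_carrier finite_monoid A"
  let ?D = "discrete_topology (carrier F)"
  have "continuous_map ?P ?D (\<lambda>p. \<phi> (fst p))" "continuous_map ?P ?D (\<lambda>p. \<phi> (snd p))"
    using continuous_map_compose[OF continuous_map_fst continuous]
      continuous_map_compose[OF continuous_map_snd continuous] by (simp_all add: o_def)
  then have "continuous_map ?P (prod_topology ?D ?D) (\<lambda>p. (\<phi> (fst p), \<phi> (snd p)))"
    by (intro continuous_map_pairedI)
  moreover have "closedin (prod_topology ?D ?D) (R \<inter> carrier F \<times> carrier F)"
    by (simp flip: prod_topology_discrete_topology)
  ultimately have "closedin ?P {p \<in> topspace ?P. (\<phi> (fst p), \<phi> (snd p)) \<in> R \<inter> carrier F \<times> carrier F}"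
    by (rule closedin_continuous_map_preimage)
  moreover have "{p \<in> topspace ?P. (\<phi> (fst p), \<phi> (snd p)) \<in> R \<inter> carrier F \<times> carrier F}
      = {(u, v) \<in> ?C \<times> ?C. (\<phi> u, \<phi> v) \<in> R}"
    by (auto simp: map_closed)
  ultimately show ?thesis by simp
qed

lemma sigma_stage_preimage:
  fixes \<beta> :: "'o::wellorder"
  assumes trans: "trans R" and refl: "\<And>a. a \<in> carrier F \<Longrightarrow> (a, a) \<in> R"
    and insert: "\<And>p q t. \<lbrakk>p \<in> carrier F; q \<in> carrier F; t \<in> carrier F\<rbrakk>
      \<Longrightarrow> (p \<otimes>\<^bsub>F\<^esub> q, p \<otimes>\<^bsub>F\<^esub> t [^]\<^bsub>F\<^esub> n \<otimes>\<^bsub>F\<^esub> q) \<in> R"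
  shows "sigma_stage n A \<beta> \<subseteq>
    {(u, v) \<in> pro_carrier finite_monoid A \<times> pro_carrier finite_monoid A. (\<phi> u, \<phi> v) \<in> R}"
    (is "_ \<subseteq> ?R")
proof (induction \<beta> rule: less_induct)
  case (less \<beta>)
  have base: "sigma_base n A \<subseteq> ?R"
    using insert by (auto simp: sigma_base_def map_closed map_mult map_pow pw_mult_closed pw_pow_closed refl)
  have "trans ?R"
    using trans by (fastforce intro!: transI dest: transD)
  then have tr: "S\<^sup>+ \<subseteq> ?R" if "S \<subseteq> ?R" for S
    using trancl_mono_subset[OF that] by simp
  have cl: "prod_topology (pw_top A) (pw_top A) closure_of S \<subseteq> ?R" if "S \<subseteq> ?R" for S
    using closure_of_minimal[OF that closedin_rel_preimage] .
  show ?case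
  \<comment> \<open>At a successor both constructions, transitive closure and topological closure,
    stay inside \<open>?R\<close>; otherwise the stage is the base or a union of earlier
    stages.\<close>
  proof (cases "\<exists>\<alpha>. succ_of \<beta> \<alpha>")
    case True
    then have "sigma_stage n A (pred_ord \<beta>) \<subseteq> ?R"
      using less pred_ord_less by blast
    then show ?thesis
      using True tr cl by (subst sigma_stage.simps) simp
  next
    case False
    then show ?thesis
      using base less by (subst sigma_stage.simps) auto
  qed
qed

end

section \<open>Regularity over the pseudovariety\<close>

lemma regular_element_hom:
  assumes "f \<in> monoid_hom M N" "regular_element M s" and M: "monoid M"
  shows "regular_element N (f s)"
proof -
  interpret M: monoid M by (rule M)
  obtain t where st: "s \<in> carrier M" "t \<in> carrier M" and t: "s \<otimes>\<^bsub>M\<^esub> t \<otimes>\<^bsub>M\<^esub> s = s"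
    using assms(2) by (auto simp: regular_element_def)
  have f: "f \<in> hom M N"
    using assms(1) by (simp add: monoid_hom_def)
  have "f (s \<otimes>\<^bsub>M\<^esub> t \<otimes>\<^bsub>M\<^esub> s) = f s \<otimes>\<^bsub>N\<^esub> f t \<otimes>\<^bsub>N\<^esub> f s"
    using st by (simp add: hom_mult[OF f])
  then show ?thesis
    using st t hom_in_carrier[OF f] by (auto simp: regular_element_def)
qed

lemma group_element_regular:
  assumes "group_element M s"
  shows "regular_element M s"
proof -
  obtain H e where H: "H \<subseteq> carrier M" "s \<in> H" and "group \<lparr>carrier = H, mult = mult M, one = e\<rparr>"
    using assms by (auto simp: group_element_def)
  then interpret group "\<lparr>carrier = H, mult = mult M, one = e\<rparr>" by simp
  let ?G = "\<lparr>carrier = H, mult = mult M, one = e\<rparr>"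
  have "inv\<^bsub>?G\<^esub> s \<in> H"
    using inv_closed H by simp
  moreover have "s = s \<otimes>\<^bsub>M\<^esub> inv\<^bsub>?G\<^esub> s \<otimes>\<^bsub>M\<^esub> s"
    using r_inv[of s] l_one[of s] H by simp
  ultimately show ?thesis
    using H unfolding regular_element_def by blast
qed

lemma has_over_group_regular: "has_over group_element V A w \<Longrightarrow> has_over regular_element V A w"
  by (simp add: has_over_def group_element_regular)

text \<open>Regularity is given only in the free pro-\<open>BGn n\<close> monoid. The quotient
  through which \<open>\<phi>\<close> factors embeds into \<open>F\<close>, so it is an index of
  that monoid too, and the projection keeps the coordinate there.\<close>

lemma (in continuous_hom) regular_image:
  assumes F: "BGn n F" and w: "w \<in> pro_carrier finite_monoid A" and "has_over regular_element (BGn n) A w"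
  shows "regular_element F (\<phi> w)"
proof -
  obtain \<theta> \<psi> where \<theta>: "\<theta> \<in> pro_index finite_monoid A"
    and \<psi>: "\<psi> \<in> monoid_hom (quot_monoid A \<theta>) F" "inj_on \<psi> (lists A // \<theta>)"
    and eq: "\<phi> w = \<psi> (w \<theta>)"
    using factors_through_index w by blast
  have "BGn n (quot_monoid A \<theta>)"
    using BGn_embedding[OF \<psi>(1) _ _ F] \<psi>(2) \<theta> by (simp add: pro_index_def)
  then have \<theta>': "\<theta> \<in> pro_index (BGn n) A"
    using \<theta> by (simp add: pro_index_def)
  have "regular_element (quot_monoid A \<theta>) (pro_proj (BGn n) A w \<theta>)"
    using regular_element_hom[OF coord_monoid_hom[OF \<theta>'] _ monoid_pro_monoid] assms(3) by (simp add: has_over_def)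
  then show ?thesis
    using regular_element_hom[OF \<psi>(1) _ quot_monoid_pro_index[OF \<theta>]] \<theta>' eq by (simp add: pro_proj_def)
qed

lemma (in continuous_hom) provable_le_image:
  assumes F: "bg_exponent F n k" and uv: "provable_le TYPE('o::wellorder) n A u v"
  shows "(\<phi> u, \<phi> v) \<in> bg_exponent.le F k"
proof -
  interpret B: bg_exponent F n k by (rule F)
  show ?thesis
    using sigma_stage_preimage[OF B.trans_le B.le_refl B.le_insert] uv
    unfolding provable_le_def by blast
qed

section \<open>Reduction to equations in finite monoids, and the theorem\<close>

lemma holds_inD:
  "\<lbrakk>holds_in V A u v; finite_monoid F; V F; continuous_hom A F \<phi>\<rbrakk> \<Longrightarrow> \<phi> u = \<phi> v"
  by (simp add: holds_in_def satisfies_iff)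

text \<open>Finiteness of \<open>F\<close> supplies an exponent \<open>k\<close> that makes
  \<open>F\<close> a \<open>bg_exponent\<close> and through which \<open>\<phi>\<close> evaluates
  omega powers.\<close>

lemma holds_inI:
  assumes "\<And>(F :: nat monoid) \<phi> k. \<lbrakk>BGn n F; bg_exponent F n k; continuous_hom A F \<phi>;
      \<And>s. s \<in> pro_carrier finite_monoid A \<Longrightarrow> \<phi> (pw_omega A s) = \<phi> s [^]\<^bsub>F\<^esub> k\<rbrakk> \<Longrightarrow> \<phi> u = \<phi> v"
  shows "holds_in (BGn n) A u v"
  unfolding holds_in_def
proof (intro allI impI)
  fix F :: "nat monoid"
  assume F: "finite_monoid F \<and> BGn n F"
  then obtain k :: nat where k: "0 < k" "\<forall>x\<in>carrier F. x [^]\<^bsub>F\<^esub> k \<otimes>\<^bsub>F\<^esub> x [^]\<^bsub>F\<^esub> k = x [^]\<^bsub>F\<^esub> k"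
    using monoid.ex_idempotent_exponent unfolding finite_monoid_def by blast
  have "\<phi> u = \<phi> v" if \<phi>: "continuous_hom A F \<phi>" for \<phi>
  proof -
    interpret continuous_hom A F \<phi> by (rule \<phi>)
    show ?thesis
      using map_omega[OF _ k(1)] k(2) map_closed BGn_bg_exponent[OF _ k] F
      by (intro assms[OF _ _ \<phi>]) blast+
  qed
  then show "satisfies F A u v"
    using F by (simp add: satisfies_iff)
qed

theorem theorem8p2:
  fixes n :: nat and A :: "'a set" and u v :: "'a pseudoword"
  assumes "n \<ge> 1" and "finite A"
    and "u \<in> carrier (pw_monoid A)" and "v \<in> carrier (pw_monoid A)"
    and "provable TYPE('o::wellorder) n A u v"
  shows "(has_over group_element (BGn n) A u \<and> has_over group_element (BGn n) A v
           \<longrightarrow> holds_in (BGn n) A u v) \<and>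
         (\<forall>w \<in> carrier (pw_monoid A). \<forall>z \<in> carrier (pw_monoid A).
           holds_in (BGn n) A u
             (pw_omega A (w \<otimes>\<^bsub>pw_monoid A\<^esub> z) \<otimes>\<^bsub>pw_monoid A\<^esub> w) \<longrightarrow>
           holds_in (BGn n) A u
             (v \<otimes>\<^bsub>pw_monoid A\<^esub> pw_omega A (z \<otimes>\<^bsub>pw_monoid A\<^esub> w)) \<and>
           holds_in (BGn n) A u
             (pw_omega A (w \<otimes>\<^bsub>pw_monoid A\<^esub> z) \<otimes>\<^bsub>pw_monoid A\<^esub> v)) \<and>
         (has_over regular_element (BGn n) A u \<and> has_over regular_element (BGn n) A v
           \<longrightarrow> holds_in (BGn n) A u v)"
proof -
  have u: "u \<in> pro_carrier finite_monoid A" and v: "v \<in> pro_carrier finite_monoid A"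
    using assms by simp_all
  have le: "provable_le TYPE('o) n A u v" "provable_le TYPE('o) n A v u"
    using assms(5) by (simp_all add: provable_def)
  \<comment> \<open>Claim (c), which also yields (a) through
    \<open>has_over_group_regular\<close>.\<close>
  have regular: "holds_in (BGn n) A u v"
    if "has_over regular_element (BGn n) A u" "has_over regular_element (BGn n) A v"
  proof (rule holds_inI)
    fix F :: "nat monoid" and \<phi> k
    assume F: "BGn n F" "bg_exponent F n k" and "continuous_hom A F \<phi>"
    then interpret \<Phi>: continuous_hom A F \<phi> by simp
    show "\<phi> u = \<phi> v"
      using \<Phi>.provable_le_image[OF F(2)] le \<Phi>.regular_image[OF F(1)] u v that
      by (intro bg_exponent.le_antisym_regular[OF F(2)])
  qed
  \<comment> \<open>Claim (b): under \<open>\<phi>\<close> the assumed pseudoidentity becomes the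
    equation that \<open>le_antisym_stable\<close> asks for.\<close>
  have stable: "holds_in (BGn n) A u (v \<otimes>\<^bsub>pw_monoid A\<^esub> pw_omega A (z \<otimes>\<^bsub>pw_monoid A\<^esub> w))"
      "holds_in (BGn n) A u (pw_omega A (w \<otimes>\<^bsub>pw_monoid A\<^esub> z) \<otimes>\<^bsub>pw_monoid A\<^esub> v)"
    if w: "w \<in> pro_carrier finite_monoid A" and z: "z \<in> pro_carrier finite_monoid A"
      and u_eq: "holds_in (BGn n) A u (pw_omega A (w \<otimes>\<^bsub>pw_monoid A\<^esub> z) \<otimes>\<^bsub>pw_monoid A\<^esub> w)" for w z
  proof -
    have eqs: "\<phi> u = \<phi> (v \<otimes>\<^bsub>pw_monoid A\<^esub> pw_omega A (z \<otimes>\<^bsub>pw_monoid A\<^esub> w))"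
      "\<phi> u = \<phi> (pw_omega A (w \<otimes>\<^bsub>pw_monoid A\<^esub> z) \<otimes>\<^bsub>pw_monoid A\<^esub> v)"
      if F: "BGn n F" "bg_exponent F n k" and "continuous_hom A F \<phi>"
        and om: "\<And>s. s \<in> pro_carrier finite_monoid A \<Longrightarrow> \<phi> (pw_omega A s) = \<phi> s [^]\<^bsub>F\<^esub> k"
      for F :: "nat monoid" and \<phi> k
    proof -
      interpret \<Phi>: continuous_hom A F \<phi> by fact
      note simps = \<Phi>.map_mult pw_mult_closed pw_omega_closed om u v w z
      have "\<phi> u = \<phi> (pw_omega A (w \<otimes>\<^bsub>pw_monoid A\<^esub> z) \<otimes>\<^bsub>pw_monoid A\<^esub> w)"
        by (rule holds_inD[OF u_eq \<Phi>.finite_target F(1) \<open>continuous_hom A F \<phi>\<close>])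
      then have "\<phi> u = (\<phi> w \<otimes>\<^bsub>F\<^esub> \<phi> z) [^]\<^bsub>F\<^esub> k \<otimes>\<^bsub>F\<^esub> \<phi> w"
        by (simp only: simps)
      from bg_exponent.le_antisym_stable[OF F(2) \<Phi>.provable_le_image[OF F(2) le(1)]
          \<Phi>.provable_le_image[OF F(2) le(2)] \<Phi>.map_closed[OF w] \<Phi>.map_closed[OF z] this]
      show "\<phi> u = \<phi> (v \<otimes>\<^bsub>pw_monoid A\<^esub> pw_omega A (z \<otimes>\<^bsub>pw_monoid A\<^esub> w))"
        "\<phi> u = \<phi> (pw_omega A (w \<otimes>\<^bsub>pw_monoid A\<^esub> z) \<otimes>\<^bsub>pw_monoid A\<^esub> v)"
        by (simp_all only: simps)
    qed
    show "holds_in (BGn n) A u (v \<otimes>\<^bsub>pw_monoid A\<^esub> pw_omega A (z \<otimes>\<^bsub>pw_monoid A\<^esub> w))"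
      by (rule holds_inI) (rule eqs(1))
    show "holds_in (BGn n) A u (pw_omega A (w \<otimes>\<^bsub>pw_monoid A\<^esub> z) \<otimes>\<^bsub>pw_monoid A\<^esub> v)"
      by (rule holds_inI) (rule eqs(2))
  qed
  show ?thesis
    using regular stable has_over_group_regular[of "BGn n" A] by simp
qed

end
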